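(* There exists $q_0$ such that for every even prime power $q\geq q_0$ (i.e. $q$ a power of $2$), $s_{q^4/q}(3,2)=5$.
   Context: For an $\mathbb{F}_q$-subspace $U$ of $\mathbb{F}_{q^m}^k$, $L_U=\{\langle u\rangle_{\mathbb{F}_{q^m}} : u\in U\setminus\{0\}\}\subseteq \mathrm{PG}(k-1,q^m)$. For $\mathcal S\subseteq \mathrm{PG}(k-1,q^m)$, a point $Q$ is $(\rho-1)$-saturated by $\mathcal S$ if there are $\rho$ points $P_1,\dots,P_\rho\in\mathcal S$ with $Q\in\langle P_1,\dots,P_\rho\rangle_{\mathbb{F}_{q^m}}$; $\mathcal S$ is a $(\rho-1)$-saturating set if every point of $\mathrm{PG}(k-1,q^m)$ is $(\rho-1)$-saturated by $\mathcal S$ and $\rho$ is the smallest value with this property. $U$ is a rank $\rho$-saturating system if $L_U$ is a $(\rho-1)$-saturating set. $s_{q^m/q}(k,\rho)$ denotes the minimal $\mathbb{F}_q$-dimension of a rank $\rho$-saturating system in $\mathbb{F}_{q^m}^k$. The paper states the result as "If $q$ is even and large enough, then $s_{q^4/q}(3,2)=5$." *)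

theory Defs
  imports
    "HOL-Algebra.Algebraic_Closure_Type"
    "HOL-Library.Z2"
    "HOL-Number_Theory.Prime_Powers"
    "Jordan_Normal_Form.VS_Connect"
begin

text \<open>
  All finite fields of a given characteristic are taken inside one algebraically closed ambient
  field, where the field of order \<open>q\<close> is unique and consists of the roots of \<open>X ^ q - X\<close>.
  For even \<open>q\<close> the ambient field is \<open>bit alg_closure\<close>, the algebraic closure of the
  field with two elements. Fixing this type lets a threshold on \<open>q\<close> be chosen before the
  field, which a type variable for the field would not allow.
\<close>

definition GF :: "nat \<Rightarrow> 'a::field set" where
  "GF q = {x. x ^ q = x}"

definition field_on :: "'a::field set \<Rightarrow> 'a ring" where
  "field_on K = class_ring\<lparr>carrier := K\<rparr>"

definition tuple_space :: "'a::field set \<Rightarrow> nat \<Rightarrow> ('a, 'a vec) module" where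
  "tuple_space E k = (module_vec TYPE('a) k)\<lparr>carrier := {v \<in> carrier_vec k. \<forall>i<k. v $ i \<in> E}\<rparr>"

definition span_over :: "'a::field set \<Rightarrow> nat \<Rightarrow> 'a vec set \<Rightarrow> 'a vec set" where
  "span_over E k = LinearCombinations.module.span (field_on E) (tuple_space E k)"

text \<open>
  Subspaces of the projective space are identified with the corresponding linear subspaces of
  \<open>E ^ k\<close>, so a point is a set of vectors, and incidence is inclusion. Thus \<open>PG E k\<close> is the set of
  points of the \<open>(k - 1)\<close>-dimensional projective space over \<open>E\<close>.
\<close>

definition linear_set :: "'a::field set \<Rightarrow> nat \<Rightarrow> 'a vec set \<Rightarrow> 'a vec set set" where
  "linear_set E k U = {span_over E k {u} | u. u \<in> U - {0\<^sub>v k}}"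

definition PG :: "'a::field set \<Rightarrow> nat \<Rightarrow> 'a vec set set" where
  "PG E k = {span_over E k {v} | v. v \<in> carrier (tuple_space E k) - {0\<^sub>v k}}"

text \<open>
  In the next two definitions the parameter is the number \<open>r\<close> of points: they say
  ``\<open>(r - 1)\<close>-saturated'' and ``\<open>(r - 1)\<close>-saturating set''. The \<open>r\<close> points need not be distinct.
\<close>

definition saturated_by :: "'a::field set \<Rightarrow> nat \<Rightarrow> nat \<Rightarrow> 'a vec set set \<Rightarrow> 'a vec set \<Rightarrow> bool" where
  "saturated_by E k r S Q \<longleftrightarrow>
     (\<exists>Ps. length Ps = r \<and> set Ps \<subseteq> S \<and> Q \<subseteq> span_over E k (\<Union>(set Ps)))"

definition saturating_set :: "'a::field set \<Rightarrow> nat \<Rightarrow> nat \<Rightarrow> 'a vec set set \<Rightarrow> bool" where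
  "saturating_set E k r S \<longleftrightarrow>
     S \<subseteq> PG E k \<and>
     (\<forall>Q\<in>PG E k. saturated_by E k r S Q) \<and>
     (\<forall>r'. (\<forall>Q\<in>PG E k. saturated_by E k r' S Q) \<longrightarrow> r \<le> r')"

definition rank_saturating_system ::
    "'a::field set \<Rightarrow> 'a set \<Rightarrow> nat \<Rightarrow> nat \<Rightarrow> 'a vec set \<Rightarrow> bool" where
  "rank_saturating_system E F k r U \<longleftrightarrow>
     VectorSpace.subspace (field_on F) U (tuple_space E k) \<and>
     saturating_set E k r (linear_set E k U)"

definition dim_over :: "'a::field set \<Rightarrow> 'a set \<Rightarrow> nat \<Rightarrow> 'a vec set \<Rightarrow> nat" where
  "dim_over E F k U = vectorspace.dim (field_on F) ((tuple_space E k)\<lparr>carrier := U\<rparr>)"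

text \<open>
  With \<open>E\<close> a subfield of order \<open>q ^ m\<close> and \<open>F \<subseteq> E\<close> the subfield of order \<open>q\<close>, this is \<open>s_{q^m/q}(k, r)\<close>. The infimum of the empty
  set of natural numbers is \<open>0\<close>, so a positive value is always attained.
\<close>

definition min_saturating_rank :: "'a::field set \<Rightarrow> 'a set \<Rightarrow> nat \<Rightarrow> nat \<Rightarrow> nat" where
  "min_saturating_rank E F k r = Inf {dim_over E F k U | U. rank_saturating_system E F k r U}"

text \<open>
  Soundness of the encoding: for a power \<open>q\<close> of \<open>2\<close> the set \<open>GF q\<close> is a field of order \<open>q\<close>, and
  \<open>tuple_space (GF (q ^ m)) k\<close> is a vector space over both \<open>GF (q ^ m)\<close> and \<open>GF q\<close>.
\<close>

lemma CHAR_bit [simp]: "CHAR(bit) = 2"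
proof (rule CHAR_eqI)
  fix n assume "of_nat n = (0 :: bit)"
  then have "even (of_nat n :: bit)" by simp
  then show "2 dvd n" by (simp only: even_of_nat)
qed simp

lemma GF_closed:
  assumes "prime CHAR('a::field)" and "q = CHAR('a) ^ h"
  shows "(0::'a) \<in> GF q" "(1::'a) \<in> GF q"
    "\<And>x y :: 'a. x \<in> GF q \<Longrightarrow> y \<in> GF q \<Longrightarrow> x + y \<in> GF q"
    "\<And>x y :: 'a. x \<in> GF q \<Longrightarrow> y \<in> GF q \<Longrightarrow> x * y \<in> GF q"
    "\<And>x :: 'a. x \<in> GF q \<Longrightarrow> - x \<in> GF q"
    "\<And>x :: 'a. x \<in> GF q \<Longrightarrow> inverse x \<in> GF q"
proof -
  have q0: "q > 0" using assms by (simp add: prime_gt_0_nat)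
  show z: "(0::'a) \<in> GF q" using q0 by (simp add: GF_def)
  show "(1::'a) \<in> GF q" by (simp add: GF_def)
  have add: "(x + y) ^ q = x ^ q + y ^ q" for x y :: 'a
    using freshmans_dream'[OF assms(1), of q h x y] assms(2) by simp
  show "x + y \<in> GF q" if "x \<in> GF q" "y \<in> GF q" for x y :: 'a
    using that by (simp add: GF_def add)
  show "x * y \<in> GF q" if "x \<in> GF q" "y \<in> GF q" for x y :: 'a
    using that by (simp add: GF_def power_mult_distrib)
  show "- x \<in> GF q" if "x \<in> GF q" for x :: 'a
  proof -
    have "x ^ q + (- x) ^ q = 0" using add[of x "- x"] q0 by (simp add: zero_power)
    then show ?thesis using that by (simp add: GF_def eq_neg_iff_add_eq_0 add.commute)
  qed
  show "inverse x \<in> GF q" if "x \<in> GF q" for x :: 'a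
    using that by (simp add: GF_def power_inverse)
qed

lemma GF_subset_GF_power: "GF q \<subseteq> (GF (q ^ m) :: 'a::field set)"
proof
  fix x :: 'a assume "x \<in> GF q"
  then have x: "x ^ q = x" by (simp add: GF_def)
  have "x ^ (q ^ m) = x"
  proof (induction m)
    case (Suc m)
    have "x ^ (q ^ Suc m) = (x ^ q) ^ (q ^ m)" by (simp add: power_mult)
    then show ?case using x Suc by simp
  qed simp
  then show "x \<in> GF (q ^ m)" by (simp add: GF_def)
qed

lemma card_GF:
  assumes "prime CHAR('a::alg_closed_field)" and "q = CHAR('a) ^ h" and "h > 0"
  shows "card (GF q :: 'a set) = q"
proof -
  define p :: "'a poly" where "p = monom 1 q - monom 1 1"
  have q1: "q > 1"
    using assms prime_gt_1_nat one_less_power by blast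
  have deg: "degree p = q"
    unfolding p_def diff_conv_add_uminus using q1
    by (subst degree_add_eq_left) (auto simp: degree_monom_eq)
  then have p0: "p \<noteq> 0" using q1 by auto
  have roots: "{x. poly p x = 0} = GF q"
    by (auto simp: p_def GF_def poly_monom)
  have "of_nat q = (0::'a)" using assms by (simp add: of_nat_eq_0_iff_char_dvd)
  then have "poly (pderiv p) x = - 1" for x
    by (simp add: p_def pderiv_diff pderiv_monom poly_monom)
  then have pd: "poly (pderiv p) x \<noteq> 0" for x by simp
  have ord: "order x p = 1" if "poly p x = 0" for x
  proof (rule ccontr)
    assume "order x p \<noteq> 1"
    moreover have "order x p \<noteq> 0" using that p0 by (simp add: order_root)
    ultimately have "[:-x, 1:] ^ 2 dvd p"
      using order_divides by (metis One_nat_def Suc_1 Suc_leI le_neq_implies_less neq0_conv)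
    then obtain r where r: "p = [:-x, 1:] * ([:-x, 1:] * r)"
      unfolding power2_eq_square by (metis dvd_def mult.assoc)
    have "poly (pderiv p) x = 0"
      unfolding r pderiv_mult poly_add poly_mult by simp
    with pd show False by simp
  qed
  obtain A where A: "size A = degree p" "p = Polynomial.smult (lead_coeff p) (\<Prod>x\<in>#A. [:-x, 1:])"
    using alg_closed_imp_factorization[OF p0] by metis
  have "proots (\<Prod>x\<in>#B. [:-x, 1:]) = B" for B :: "'a multiset"
  proof (induction B)
    case (add x B)
    have "(\<Prod>x\<in>#B. [:-x, 1:]) \<noteq> 0" by (auto simp: prod_mset_zero_iff)
    then have "proots ([:-x, 1:] * (\<Prod>x\<in>#B. [:-x, 1:])) = add_mset x B"
      by (subst proots_mult) (use add in auto)
    then show ?case by (simp only: image_mset_add_mset prod_mset.add_mset)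
  qed simp
  then have A_eq: "proots p = A"
    using A(2) p0 by (metis leading_coeff_0_iff proots_smult)
  have "count A x = 1" if "x \<in># A" for x
    using ord[of x] p0 that A_eq by (metis count_proots mem_Collect_eq set_count_proots)
  then have "A = mset_set (set_mset A)"
    by (intro multiset_eqI) (auto simp: count_mset_set' not_in_iff)
  then have "card (set_mset A) = size A"
    by (metis size_mset_set)
  moreover have "set_mset A = GF q"
    using A_eq roots p0 by (metis set_count_proots)
  ultimately show ?thesis using A(1) deg by simp
qed

lemma
  fixes E F :: "'a::field set"
  assumes "\<And>K. K \<in> {E, F} \<Longrightarrow> 0 \<in> K \<and> 1 \<in> K \<and> (\<forall>x\<in>K. \<forall>y\<in>K. x + y \<in> K \<and> x * y \<in> K) \<and>
     (\<forall>x\<in>K. - x \<in> K \<and> inverse x \<in> K)"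
    and "F \<subseteq> E"
  shows field_field_on: "Ring.field (field_on F)"
    and vectorspace_tuple_space: "vectorspace (field_on F) (tuple_space E k)"
proof -
  have K: "0 \<in> K" "1 \<in> K" "\<And>x y. x \<in> K \<Longrightarrow> y \<in> K \<Longrightarrow> x + y \<in> K"
    "\<And>x y. x \<in> K \<Longrightarrow> y \<in> K \<Longrightarrow> x * y \<in> K" "\<And>x. x \<in> K \<Longrightarrow> - x \<in> K"
    "\<And>x. x \<in> K \<Longrightarrow> inverse x \<in> K" if "K \<in> {E, F}" for K
    using assms(1)[OF that] by auto
  note KF = K[of F, simplified] and KE = K[of E, simplified]
  have neg: "\<exists>y\<in>F. y + x = 0 \<and> x + y = 0" if "x \<in> F" for x
    using KF(5)[OF that] by (intro bexI[of _ "- x"]) auto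
  have invF: "\<exists>y\<in>F. y * x = 1 \<and> x * y = 1" if "x \<in> F" "x \<noteq> 0" for x
    using KF(6)[OF that(1)] that(2) by (intro bexI[of _ "inverse x"]) auto
  show fld: "Ring.field (field_on F)"
    unfolding field_on_def
    using KF(1-4) neg invF
    by unfold_locales (auto simp: Units_def algebra_simps)
  interpret F: Ring.field "field_on F" by (rule fld)
  have negV: "\<exists>y\<in>carrier (tuple_space E k). y + v = 0\<^sub>v k \<and> v + y = 0\<^sub>v k"
    if "v \<in> carrier (tuple_space E k)" for v
    using that KE(5)
    by (intro bexI[of _ "- v"]) (auto simp: tuple_space_def module_vec_simps)
  interpret V: abelian_group "tuple_space E k"
    using negV KE(1,3)
    by unfold_locales (auto simp: Units_def tuple_space_def module_vec_simps)
  show "vectorspace (field_on F) (tuple_space E k)"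
    using KE(4) assms(2)
    by unfold_locales
      (auto simp: field_on_def tuple_space_def module_vec_simps add_smult_distrib_vec
        smult_add_distrib_vec smult_smult_assoc subset_iff)
qed

lemma finite_fields_char_2:
  assumes "primepow q" and "even q"
  shows "card (GF q :: bit alg_closure set) = q"
    and "Ring.field (field_on (GF q :: bit alg_closure set))"
    and "m > 0 \<Longrightarrow> card (GF (q ^ m) :: bit alg_closure set) = q ^ m"
    and "Ring.field (field_on (GF (q ^ m) :: bit alg_closure set))"
    and "vectorspace (field_on (GF q)) (tuple_space (GF (q ^ m) :: bit alg_closure set) k)"
    and "vectorspace (field_on (GF (q ^ m))) (tuple_space (GF (q ^ m) :: bit alg_closure set) k)"
proof -
  let ?c = "CHAR(bit alg_closure)"
  have c: "?c = 2" "prime ?c" by simp_all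
  obtain p h where ph: "prime p" "h > 0" "q = p ^ h"
    using assms(1) by (auto simp: primepow_def)
  with assms(2) have "p = 2" by (metis even_power primes_dvd_imp_eq two_is_prime_nat)
  with ph have q: "q = ?c ^ h" and h: "h > 0" by simp_all
  then have qm: "q ^ m = ?c ^ (h * m)" for m by (simp add: power_mult)
  show "card (GF q :: bit alg_closure set) = q"
    by (rule card_GF[OF c(2) q h])
  show "card (GF (q ^ m) :: bit alg_closure set) = q ^ m" if "m > 0"
    using card_GF[OF c(2) qm] h that by simp
  note cl = GF_closed[OF c(2) q] GF_closed[OF c(2) qm]
  have sub: "GF q \<subseteq> (GF (q ^ m) :: bit alg_closure set)" by (rule GF_subset_GF_power)
  show "Ring.field (field_on (GF q :: bit alg_closure set))"
    by (rule field_field_on[where E = "GF q"]) (auto intro: cl)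
  show "Ring.field (field_on (GF (q ^ m) :: bit alg_closure set))"
    by (rule field_field_on[where E = "GF (q ^ m)"]) (auto intro: cl)
  show "vectorspace (field_on (GF q)) (tuple_space (GF (q ^ m) :: bit alg_closure set) k)"
    by (rule vectorspace_tuple_space) (use sub in \<open>auto intro: cl\<close>)
  show "vectorspace (field_on (GF (q ^ m))) (tuple_space (GF (q ^ m) :: bit alg_closure set) k)"
    by (rule vectorspace_tuple_space) (auto intro: cl)
qed

end

theory Submission
  imports Defs
begin

text \<open>
  Let \<open>F\<close>, \<open>K\<close>, \<open>E\<close> be the fields of order \<open>q\<close>, \<open>q\<^sup>2\<close>, \<open>q\<^sup>4\<close>.

  Upper bound: three elements of \<open>E\<close> are dependent over \<open>K\<close>, so every point of the plane lies on a line with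
  coefficients in \<open>K\<close>, and such a line meets \<open>K \<times> K \<times> F\<close> in two points that span it.

  Lower bound: let \<open>U\<close> be spanned over \<open>F\<close> by \<open>h\<^sub>1, \<dots>, h\<^sub>4\<close>, and let \<open>g \<in> E\<^sup>4\<close> span the relations between the
  \<open>h\<^sub>j\<close>. The vector \<open>\<Sum> w\<^sub>j h\<^sub>j\<close> lies on a line through two points of \<open>L\<^sub>U\<close> iff for some \<open>m \<in> E\<close> the
  entries of \<open>w - m g\<close> span at most two dimensions over \<open>F\<close>, so it suffices to find, for every \<open>g\<close>, a \<open>w\<close> for which no
  such \<open>m\<close> exists. If the entries of \<open>g\<close> are independent, take \<open>w\<^sub>j = g\<^sub>j\<^sup>q\<close>: the map \<open>x \<mapsto> x\<^sup>q - m x\<close> has a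
  kernel of dimension at most one. If they span a space \<open>\<langle>1, x, y\<rangle>\<close> of dimension three, the condition on \<open>w\<close> becomes that
  a binary quadratic form over \<open>F\<close> is anisotropic and that its value at \<open>(x, y)\<close> is outside \<open>\<langle>1, x, y\<rangle>\<close>. Such a form exists
  because \<open>\<langle>1, x, y\<rangle>\<close> is not closed under multiplication. Smaller dimensions are easy.
\<close>

no_notation fps_nth (infixl \<open>$\<close> 75)

section \<open>Cosets without vectors of rank two\<close>

text \<open>The generators \<open>u\<close> and \<open>v\<close> may be dependent, so for a field
  \<open>F\<close> these sets are all the \<open>F\<close>-subspaces of dimension at most
  two.\<close>

definition comb2 :: "'a::field set \<Rightarrow> 'a \<Rightarrow> 'a \<Rightarrow> 'a set" where
  "comb2 F u v = {a * u + b * v | a b. a \<in> F \<and> b \<in> F}"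

definition comb3 :: "'a::field set \<Rightarrow> 'a \<Rightarrow> 'a \<Rightarrow> 'a \<Rightarrow> 'a set" where
  "comb3 F x y z = {a * x + b * y + c * z | a b c. a \<in> F \<and> b \<in> F \<and> c \<in> F}"

definition indep3 :: "'a::field set \<Rightarrow> 'a \<Rightarrow> 'a \<Rightarrow> 'a \<Rightarrow> bool" where
  "indep3 F x y z \<longleftrightarrow> (\<forall>a\<in>F. \<forall>b\<in>F. \<forall>c\<in>F. a * x + b * y + c * z = 0 \<longrightarrow> a = 0 \<and> b = 0 \<and> c = 0)"

definition indep4 :: "'a::field set \<Rightarrow> 'a \<Rightarrow> 'a \<Rightarrow> 'a \<Rightarrow> 'a \<Rightarrow> bool" where
  "indep4 F x y z t \<longleftrightarrow> (\<forall>a\<in>F. \<forall>b\<in>F. \<forall>c\<in>F. \<forall>d\<in>F.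
     a * x + b * y + c * z + d * t = 0 \<longrightarrow> a = 0 \<and> b = 0 \<and> c = 0 \<and> d = 0)"

text \<open>
  In the rank metric, the coset of \<open>w\<close> modulo the code spanned by \<open>g\<close> contains no vector of rank at most two.
\<close>

definition deep_coset :: "'a::field set \<Rightarrow> 'a set \<Rightarrow> 'a \<Rightarrow> 'a \<Rightarrow> 'a \<Rightarrow> 'a \<Rightarrow> bool" where
  "deep_coset F E g1 g2 g3 g4 \<longleftrightarrow> (\<exists>w1\<in>E. \<exists>w2\<in>E. \<exists>w3\<in>E. \<exists>w4\<in>E. \<forall>m u v.
     \<not> (w1 - m * g1 \<in> comb2 F u v \<and> w2 - m * g2 \<in> comb2 F u v \<and>
        w3 - m * g3 \<in> comb2 F u v \<and> w4 - m * g4 \<in> comb2 F u v))"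

lemma indep3D:
  "indep3 F x y z \<Longrightarrow> a * x + b * y + c * z = 0 \<Longrightarrow> a \<in> F \<Longrightarrow> b \<in> F \<Longrightarrow> c \<in> F \<Longrightarrow>
     a = 0 \<and> b = 0 \<and> c = 0"
  unfolding indep3_def by blast

lemma indep4D:
  "indep4 F x y z t \<Longrightarrow> a * x + b * y + c * z + d * t = 0 \<Longrightarrow> a \<in> F \<Longrightarrow> b \<in> F \<Longrightarrow> c \<in> F \<Longrightarrow> d \<in> F \<Longrightarrow>
     a = 0 \<and> b = 0 \<and> c = 0 \<and> d = 0"
  unfolding indep4_def by blast

lemma comb2I: "a \<in> F \<Longrightarrow> b \<in> F \<Longrightarrow> a * u + b * v \<in> comb2 F u v"
  unfolding comb2_def by blast

lemma comb3I: "a \<in> F \<Longrightarrow> b \<in> F \<Longrightarrow> c \<in> F \<Longrightarrow> a * x + b * y + c * z \<in> comb3 F x y z"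
  unfolding comb3_def by blast

text \<open>The bound \<open>h \<ge> 2\<close> gives \<open>F\<close> an element other than 0 and 1,
  from which \<open>exists_anisotropic\<close> builds its second constant.\<close>

locale quartic_extension =
  fixes F E :: "'a::alg_closed_field set" and q h :: nat
  assumes char2: "CHAR('a) = 2" and q_def: "q = 2 ^ h" and h2: "h \<ge> 2"
    and F_def: "F = GF q" and E_def: "E = GF (q ^ 4)"
begin

section \<open>Arithmetic of the fields of order \<open>q\<close> and \<open>q ^ 4\<close>, and
  planes over \<open>F\<close>\<close>

lemma prime_char: "prime CHAR('a)" using char2 by simp
lemma q_char: "q = CHAR('a) ^ h" "q ^ m = CHAR('a) ^ (h * m)"
  by (simp_all add: char2 q_def power_mult)

lemma q4: "q \<ge> 4"
  using power_increasing[OF h2, of "2::nat"] by (simp add: q_def)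

lemma card_F: "card F = q"
  using card_GF[OF prime_char q_char(1)] h2 by (simp add: F_def)

lemma card_E: "card E = q ^ 4"
  using card_GF[OF prime_char q_char(2)[of 4]] h2 by (simp add: E_def)

lemma finite_F [simp]: "finite F" and finite_E [simp]: "finite E"
  using card_F card_E q4 by (auto intro!: card_ge_0_finite)

lemmas F_closed = GF_closed[OF prime_char q_char(1), folded F_def]
lemmas E_closed = GF_closed[OF prime_char q_char(2)[of 4], folded E_def]

lemma F_simps [simp]:
  "0 \<in> F" "1 \<in> F" "x \<in> F \<Longrightarrow> y \<in> F \<Longrightarrow> x + y \<in> F" "x \<in> F \<Longrightarrow> y \<in> F \<Longrightarrow> x * y \<in> F"
  "x \<in> F \<Longrightarrow> - x \<in> F" "x \<in> F \<Longrightarrow> inverse x \<in> F" "x \<in> F \<Longrightarrow> y \<in> F \<Longrightarrow> x - y \<in> F"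
  "x \<in> F \<Longrightarrow> y \<in> F \<Longrightarrow> x / y \<in> F"
  using F_closed(3)[of x "- y"] by (auto simp: F_closed divide_inverse)

lemma E_simps [simp]:
  "0 \<in> E" "1 \<in> E" "x \<in> E \<Longrightarrow> y \<in> E \<Longrightarrow> x + y \<in> E" "x \<in> E \<Longrightarrow> y \<in> E \<Longrightarrow> x * y \<in> E"
  "x \<in> E \<Longrightarrow> - x \<in> E" "x \<in> E \<Longrightarrow> inverse x \<in> E" "x \<in> E \<Longrightarrow> y \<in> E \<Longrightarrow> x - y \<in> E"
  "x \<in> E \<Longrightarrow> y \<in> E \<Longrightarrow> x / y \<in> E"
  using E_closed(3)[of x "- y"] by (auto simp: E_closed divide_inverse)

lemma F_sub_E [simp]: "x \<in> F \<Longrightarrow> x \<in> E"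
  using GF_subset_GF_power by (auto simp: F_def E_def)

lemma E_power [simp]: "x \<in> E \<Longrightarrow> x ^ n \<in> E"
  by (induction n) auto

lemma add_frob: "(x + y) ^ q = x ^ q + (y::'a) ^ q"
  using freshmans_dream'[OF prime_char q_char(1)] by simp

lemma frob_F: "x \<in> F \<Longrightarrow> x ^ q = x"
  by (simp add: F_def GF_def)

lemma double [simp]: "x + x = (0::'a)"
proof -
  have "of_nat 2 = (0::'a)" unfolding of_nat_eq_0_iff_char_dvd by (simp add: char2)
  then show ?thesis by (simp flip: mult_2)
qed

lemma comb2_lin:
  assumes "x \<in> comb2 F u v" "y \<in> comb2 F u v" "a \<in> F" "b \<in> F"
  shows "a * x + b * y \<in> comb2 F u v"
proof -
  obtain a1 b1 a2 b2 where *: "x = a1 * u + b1 * v" "y = a2 * u + b2 * v"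
    "a1 \<in> F" "b1 \<in> F" "a2 \<in> F" "b2 \<in> F"
    using assms(1,2) by (auto simp: comb2_def)
  have "a * x + b * y = (a * a1 + b * a2) * u + (a * b1 + b * b2) * v"
    by (simp add: * algebra_simps)
  also have "\<dots> \<in> comb2 F u v" using * assms(3,4) by (intro comb2I) simp_all
  finally show ?thesis .
qed

text \<open>Counting: independence would make the \<open>q ^ 3\<close> coefficient triples give
  distinct elements of a set of size at most \<open>q ^ 2\<close>.\<close>

lemma dependent3:
  assumes "x \<in> comb2 F u v" "y \<in> comb2 F u v" "z \<in> comb2 F u v"
  shows "\<not> indep3 F x y z"
proof
  assume ind: "indep3 F x y z"
  let ?f = "\<lambda>(a, b, c). a * x + b * y + c * z"
  have "inj_on ?f (F \<times> F \<times> F)"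
  proof (rule inj_onI)
    fix s t assume st: "s \<in> F \<times> F \<times> F" "t \<in> F \<times> F \<times> F" "?f s = ?f t"
    obtain a b c a' b' c' where e: "s = (a, b, c)" "t = (a', b', c')"
      by (cases s, cases t) auto
    have "(a - a') * x + (b - b') * y + (c - c') * z = 0"
      using st(3) by (simp add: e algebra_simps)
    then have "a - a' = 0 \<and> b - b' = 0 \<and> c - c' = 0"
      using st(1,2) by (intro indep3D[OF ind]) (auto simp: e)
    then show "s = t" by (simp add: e)
  qed
  moreover have "?f ` (F \<times> F \<times> F) \<subseteq> (\<lambda>(a, b). a * u + b * v) ` (F \<times> F)"
  proof clarify
    fix a b c assume abc: "a \<in> F" "b \<in> F" "c \<in> F"
    have "1 * (a * x + b * y) + c * z \<in> comb2 F u v"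
      by (intro comb2_lin assms) (use abc in auto)
    then show "a * x + b * y + c * z \<in> (\<lambda>(a, b). a * u + b * v) ` (F \<times> F)"
      by (auto simp: comb2_def)
  qed
  ultimately have "card (F \<times> F \<times> F) \<le> card ((\<lambda>(a, b). a * u + b * v) ` (F \<times> F))"
    by (intro card_inj_on_le) auto
  also have "\<dots> \<le> card (F \<times> F)" by (rule card_image_le) simp
  finally show False using q4 by (simp add: card_cartesian_product card_F)
qed

section \<open>Four independent entries: eigenspaces of the Frobenius map\<close>

lemma indep4_perm:
  assumes "indep4 F x y z t"
  shows "indep4 F y x z t" and "indep4 F x z y t"
proof -
  show "indep4 F y x z t"
    unfolding indep4_def
  proof (intro ballI impI)
    fix a b c d assume "a \<in> F" "b \<in> F" "c \<in> F" "d \<in> F" "a * y + b * x + c * z + d * t = 0"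
    then show "a = 0 \<and> b = 0 \<and> c = 0 \<and> d = 0"
      using indep4D[OF assms, of b a c d] by (simp add: add_ac)
  qed
  show "indep4 F x z y t"
    unfolding indep4_def
  proof (intro ballI impI)
    fix a b c d assume "a \<in> F" "b \<in> F" "c \<in> F" "d \<in> F" "a * x + b * z + c * y + d * t = 0"
    then show "a = 0 \<and> b = 0 \<and> c = 0 \<and> d = 0"
      using indep4D[OF assms, of a c b d] by (simp add: add_ac)
  qed
qed

text \<open>The quotient \<open>x / y\<close> is fixed by the \<open>q\<close>-th power map, because
  the factor \<open>m\<close> cancels. If \<open>m = 0\<close>, then \<open>y ^ q = 0\<close>
  contradicts \<open>y \<noteq> 0\<close>.\<close>

lemma frob_eigenspace:
  assumes "x ^ q = m * x" "y ^ q = m * y" "y \<noteq> (0::'a)"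
  shows "\<exists>r\<in>F. x = r * y"
proof (intro bexI)
  show "x / y \<in> F"
    using assms q4 by (cases "m = 0") (auto simp: F_def GF_def power_divide)
qed (use assms in auto)

text \<open>The map sending \<open>g\<close> to \<open>g ^ q - m * g\<close> is
  \<open>F\<close>-linear, so the given relation and one among the images of \<open>g2\<close>,
  \<open>g3\<close>, \<open>g4\<close> provide elements \<open>x\<close> and \<open>y\<close> of its
  kernel. Since \<open>y \<noteq> 0\<close>, the element \<open>x\<close> is an
  \<open>F\<close>-multiple of \<open>y\<close>; and \<open>y\<close> does not involve
  \<open>g1\<close>, so neither does \<open>x\<close>.\<close>

lemma frob_independent_aux:
  assumes ind: "indep4 F g1 g2 g3 g4" and L: "g2 ^ q - m * g2 \<in> comb2 F u v"
    "g3 ^ q - m * g3 \<in> comb2 F u v" "g4 ^ q - m * g4 \<in> comb2 F u v"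
    and a: "a1 \<in> F" "a2 \<in> F" "a3 \<in> F"
    "a1 * (g1 ^ q - m * g1) + a2 * (g2 ^ q - m * g2) + a3 * (g3 ^ q - m * g3) = 0"
  shows "a1 = 0"
proof -
  obtain b2 b3 b4 where b: "b2 \<in> F" "b3 \<in> F" "b4 \<in> F" "b2 \<noteq> 0 \<or> b3 \<noteq> 0 \<or> b4 \<noteq> 0"
    "b2 * (g2 ^ q - m * g2) + b3 * (g3 ^ q - m * g3) + b4 * (g4 ^ q - m * g4) = 0"
    using dependent3[OF L] unfolding indep3_def by blast
  define x y where "x = a1 * g1 + a2 * g2 + a3 * g3" and "y = b2 * g2 + b3 * g3 + b4 * g4"
  have x: "x ^ q = m * x"
    using a(4) by (simp add: x_def add_frob power_mult_distrib frob_F a algebra_simps)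
  have y: "y ^ q = m * y"
    using b(5) by (simp add: y_def add_frob power_mult_distrib frob_F b algebra_simps)
  have "y \<noteq> 0"
  proof
    assume "y = 0"
    then have "0 * g1 + b2 * g2 + b3 * g3 + b4 * g4 = 0" by (simp add: y_def)
    then show False using indep4D[OF ind, of 0 b2 b3 b4] b(1-4) by simp
  qed
  then obtain r where r: "r \<in> F" "x = r * y" using frob_eigenspace x y by blast
  have "a1 * g1 + (a2 - r * b2) * g2 + (a3 - r * b3) * g3 + (- r * b4) * g4 = 0"
    using r(2) by (simp add: x_def y_def algebra_simps)
  moreover have "a2 - r * b2 \<in> F" "a3 - r * b3 \<in> F" "- r * b4 \<in> F" using a b r by auto
  ultimately show ?thesis using indep4D[OF ind] a(1) by blast
qed

text \<open>Three of the images would satisfy a nontrivial relation;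
  \<open>frob_independent_aux\<close>, applied with each of the three generators in first place,
  makes all its coefficients vanish.\<close>

lemma deep_coset_rank4:
  assumes E: "g1 \<in> E" "g2 \<in> E" "g3 \<in> E" "g4 \<in> E" and ind: "indep4 F g1 g2 g3 g4"
  shows "deep_coset F E g1 g2 g3 g4"
  unfolding deep_coset_def
proof (intro bexI allI notI)
  fix m u v
  let ?d = "\<lambda>g::'a. g ^ q - m * g"
  \<comment> \<open>The witnesses are still schematic here; matching this assumption with the goal
    sets them to \<open>g1 ^ q\<close>, ..., \<open>g4 ^ q\<close>.\<close>
  assume L: "?d g1 \<in> comb2 F u v \<and> ?d g2 \<in> comb2 F u v \<and> ?d g3 \<in> comb2 F u v \<and> ?d g4 \<in> comb2 F u v"
  obtain a b c where a: "a \<in> F" "b \<in> F" "c \<in> F" "a * ?d g1 + b * ?d g2 + c * ?d g3 = 0"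
     and n: "a \<noteq> 0 \<or> b \<noteq> 0 \<or> c \<noteq> 0"
    using dependent3[of "?d g1" u v "?d g2" "?d g3"] L unfolding indep3_def by blast
  have "a = 0"
    by (rule frob_independent_aux[OF ind _ _ _ a]) (use L in auto)
  moreover have "b = 0"
    by (rule frob_independent_aux[OF indep4_perm(1)[OF ind], of m u v b a c])
      (use L a in \<open>auto simp: add_ac\<close>)
  moreover have "c = 0"
    by (rule frob_independent_aux[OF indep4_perm(1)[OF indep4_perm(2)[OF ind]], of m u v c a b])
      (use L a in \<open>auto simp: add_ac\<close>)
  ultimately show False using n by simp
qed (use E in auto)

section \<open>Three independent entries: anisotropic binary quadratic forms\<close>

lemma two_eq_0 [simp]: "2 = (0::'a)"
  using double[of 1] by (metis one_add_one)

lemma uminus_eq [simp]: "- x = (x::'a)"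
  by (rule minus_unique) simp

text \<open>Artin-Schreier theory: dividing by \<open>s * s\<close> turns a nontrivial zero into
  \<open>c = f (t / s)\<close> with \<open>f y = y * y + y\<close>. The additive map
  \<open>f\<close> has 0 and 1 in its kernel, so it misses some \<open>a\<close> in the finite set
  \<open>F\<close>. Adding a nonzero value \<open>f y\<close> to \<open>a\<close> stays outside the
  image and gives the second constant.\<close>

lemma exists_anisotropic:
  "\<exists>a\<in>F. \<exists>b\<in>F. a \<noteq> b \<and>
     (\<forall>c\<in>{a, b}. \<forall>s\<in>F. \<forall>t\<in>F. c * s * s + s * t + t * t = 0 \<longrightarrow> s = 0 \<and> t = 0)"
proof -
  define f where "f = (\<lambda>y::'a. y * y + y)"
  have "\<not> inj_on f F"
  proof
    assume "inj_on f F"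
    then show False using inj_onD[of f F 0 1] by (simp add: f_def)
  qed
  then have "\<not> F \<subseteq> f ` F" using finite_surj_inj[of F f] by auto
  then obtain a where a: "a \<in> F" "a \<notin> f ` F" by auto
  have "\<not> F \<subseteq> {0, 1}"
  proof
    assume "F \<subseteq> {0, 1}"
    then have "card F \<le> card {0, 1::'a}" by (intro card_mono) auto
    then show False using q4 by (simp add: card_F)
  qed
  then obtain y where y: "y \<in> F" "y \<noteq> 0" "y \<noteq> 1" by auto
  have f_add: "f (s + t) = f s + f t" for s t
  proof -
    have "f (s + t) = f s + f t + (s * t + s * t)" by (simp add: f_def algebra_simps del: double)
    then show ?thesis by (simp only: double add_0_right)
  qed
  have b: "a + f y \<notin> f ` F"
  proof
    assume "a + f y \<in> f ` F"
    then obtain z where z: "z \<in> F" "a + f y = f z" by auto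
    have "a = a + f y + f y" by (simp add: add.assoc)
    also have "\<dots> = f (z + y)" by (simp only: z f_add)
    finally have "a \<in> f ` F" by (rule image_eqI) (use z(1) y(1) in simp)
    with a(2) show False by simp
  qed
  have "f y = y * (y + 1)" by (simp add: f_def algebra_simps)
  moreover have "y + 1 \<noteq> 0"
    using y(3) by (metis uminus_eq add_eq_0_iff)
  ultimately have "a \<noteq> a + f y" using y(2) by auto
  moreover have "s = 0 \<and> t = 0"
    if c: "c \<in> F" "c \<notin> f ` F" and st: "s \<in> F" "t \<in> F" "c * s * s + s * t + t * t = 0" for c s t
  proof (cases "s = 0")
    case True
    with st show ?thesis by simp
  next
    case False
    have "c = t / s * (t / s) + t / s"
    proof -
      have "(c + (t / s * (t / s) + t / s)) * (s * s) = 0"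
        using st(3) False by (simp add: field_simps)
      then have "c + (t / s * (t / s) + t / s) = 0" using False by simp
      then show ?thesis by (metis uminus_eq add_eq_0_iff)
    qed
    then have "c = f (t / s)" by (simp add: f_def)
    then have "c \<in> f ` F" by (rule image_eqI) (use st in simp)
    with c(2) show ?thesis by simp
  qed
  moreover have "a + f y \<in> F" using a y by (simp add: f_def)
  ultimately show ?thesis using a b by blast
qed

lemma card_comb3_le: "card (comb3 F x y z) \<le> q ^ 3" and finite_comb3 [simp]: "finite (comb3 F x y z)"
proof -
  have *: "comb3 F x y z = (\<lambda>(a, b, c). a * x + b * y + c * z) ` (F \<times> F \<times> F)"
    by (fastforce simp: comb3_def image_def)
  have "card (comb3 F x y z) \<le> card (F \<times> F \<times> F)"
    unfolding * by (rule card_image_le) simp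
  then show "card (comb3 F x y z) \<le> q ^ 3"
    by (simp add: card_cartesian_product card_F power3_eq_cube mult.assoc)
  show "finite (comb3 F x y z)" unfolding * by simp
qed

lemma comb3_inside: "\<exists>w\<in>E. w \<notin> comb3 F x y z"
proof (rule ccontr)
  assume "\<not> ?thesis"
  then have "card E \<le> card (comb3 F x y z)" by (intro card_mono) auto
  also have "\<dots> \<le> q ^ 3" by (rule card_comb3_le)
  also have "\<dots> < q ^ 4" using q4 by (intro power_strict_increasing) auto
  finally show False by (simp add: card_E)
qed

lemma comb3_lin:
  assumes "s \<in> comb3 F x y z" "t \<in> comb3 F x y z" "a \<in> F" "b \<in> F"
  shows "a * s + b * t \<in> comb3 F x y z"
proof -
  obtain a1 a2 a3 b1 b2 b3 where *: "s = a1 * x + a2 * y + a3 * z" "t = b1 * x + b2 * y + b3 * z"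
    "a1 \<in> F" "a2 \<in> F" "a3 \<in> F" "b1 \<in> F" "b2 \<in> F" "b3 \<in> F"
    using assms(1,2) unfolding comb3_def by blast
  have "a * s + b * t = (a * a1 + b * b1) * x + (a * a2 + b * b2) * y + (a * a3 + b * b3) * z"
    by (simp add: * algebra_simps)
  also have "\<dots> \<in> comb3 F x y z" using * assms(3,4) by (intro comb3I) simp_all
  finally show ?thesis .
qed

lemma comb3_basis: "x \<in> comb3 F x y z" "y \<in> comb3 F x y z" "z \<in> comb3 F x y z"
proof -
  have "1 * x + 0 * y + 0 * z \<in> comb3 F x y z" "0 * x + 1 * y + 0 * z \<in> comb3 F x y z"
    "0 * x + 0 * y + 1 * z \<in> comb3 F x y z"
    by (intro comb3I; simp)+
  then show "x \<in> comb3 F x y z" "y \<in> comb3 F x y z" "z \<in> comb3 F x y z" by simp_all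
qed

lemma comb3_add: "s \<in> comb3 F x y z \<Longrightarrow> t \<in> comb3 F x y z \<Longrightarrow> s + t \<in> comb3 F x y z"
  and comb3_scale: "s \<in> comb3 F x y z \<Longrightarrow> a \<in> F \<Longrightarrow> a * s \<in> comb3 F x y z"
  using comb3_lin[of s x y z t 1 1] comb3_lin[of s x y z s a 0] by auto

lemma card_comb3:
  assumes "indep3 F x y z"
  shows "card (comb3 F x y z) = q ^ 3"
proof -
  let ?f = "\<lambda>(a, b, c). a * x + b * y + c * z"
  have "inj_on ?f (F \<times> F \<times> F)"
  proof (rule inj_onI)
    fix s t assume st: "s \<in> F \<times> F \<times> F" "t \<in> F \<times> F \<times> F" "?f s = ?f t"
    obtain a b c a' b' c' where e: "s = (a, b, c)" "t = (a', b', c')"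
      by (cases s, cases t) auto
    have "(a - a') * x + (b - b') * y + (c - c') * z = ?f s - ?f t"
      by (simp only: e prod.case) (simp only: algebra_simps)
    then have "(a - a') * x + (b - b') * y + (c - c') * z = 0" by (simp only: st(3) diff_self)
    then have "a - a' = 0 \<and> b - b' = 0 \<and> c - c' = 0"
      using st(1,2) by (intro indep3D[OF assms]) (auto simp: e)
    then show "s = t" by (simp add: e)
  qed
  moreover have "comb3 F x y z = ?f ` (F \<times> F \<times> F)"
    by (fastforce simp: comb3_def image_def)
  ultimately show ?thesis
    by (simp add: card_image card_cartesian_product card_F power3_eq_cube mult.assoc)
qed

text \<open>A three-dimensional subalgebra would be a field of order \<open>q ^ 3\<close>, which meets \<open>E\<close> in \<open>F\<close> only.\<close>

lemma comb3_not_subalgebra: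
  assumes ind: "indep3 F 1 x y" and E: "x \<in> E"
  shows "\<not> (x * x \<in> comb3 F 1 x y \<and> x * y \<in> comb3 F 1 x y \<and> y * y \<in> comb3 F 1 x y)"
proof
  let ?T = "comb3 F 1 x y"
  assume sq: "x * x \<in> ?T \<and> x * y \<in> ?T \<and> y * y \<in> ?T"
  have xT: "x * s \<in> ?T" if s: "s \<in> ?T" for s
  proof -
    obtain a b c where *: "s = a * 1 + b * x + c * y" "a \<in> F" "b \<in> F" "c \<in> F"
      using s by (auto simp: comb3_def)
    have "a * x + b * (x * x) + c * (x * y) \<in> ?T"
      using comb3_scale[OF comb3_basis(2) *(2)] comb3_scale[OF _ *(3), of "x * x" 1 x y]
        comb3_scale[OF _ *(4), of "x * y" 1 x y] sq by (intro comb3_add) blast+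
    then show ?thesis by (simp add: * algebra_simps)
  qed
  have x0: "x \<noteq> 0"
  proof
    assume "x = 0"
    then have "0 * 1 + 1 * x + 0 * y = 0" by simp
    then show False using indep3D[OF ind] by (metis F_simps(1,2) zero_neq_one)
  qed
  \<comment> \<open>Multiplication by \<open>x\<close> is an injection of this finite set into
    itself, hence a permutation; comparing the products of all elements gives
    \<open>x ^ card ?S = 1\<close>, where \<open>card ?S\<close> is
    \<open>q ^ 3 - 1\<close>.\<close>
  let ?S = "?T - {0}"
  have "(*) x ` ?S = ?S"
    by (rule endo_inj_surj) (auto simp: xT x0 inj_on_def)
  then have "\<Prod>?S = (\<Prod>s\<in>?S. x * s)"
    using prod.reindex[of "(*) x" ?S "\<lambda>s. s"] x0 by (simp add: inj_on_def comp_def)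
  also have "\<dots> = x ^ card ?S * \<Prod>?S" by (simp add: prod.distrib)
  finally have "x ^ card ?S = 1" by (simp add: prod_zero_iff)
  moreover have "0 \<in> ?T" using comb3_scale[of x 1 x y 0] comb3_basis by simp
  then have "Suc (card ?S) = q ^ 3"
    using card_Suc_Diff1[of ?T 0] by (simp add: card_comb3[OF ind])
  ultimately have "x ^ (q ^ 3) = x" by (metis power_Suc mult_1_right)
  \<comment> \<open>Being fixed by the powers \<open>q ^ 3\<close> and \<open>q ^ 4\<close>, the
    element \<open>x\<close> is fixed by the power \<open>q\<close>.\<close>
  then have "x ^ (q ^ 3 * q) = x ^ q" by (simp add: power_mult)
  also have "q ^ 3 * q = q ^ 4" by (simp add: eval_nat_numeral)
  finally have "x \<in> F" using E by (simp add: F_def E_def GF_def)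
  then have "x * 1 + 1 * x + 0 * y = 0 \<longrightarrow> (1::'a) = 0"
    using indep3D[OF ind, of x 1 0] by simp
  then show False by simp
qed

text \<open>Modulo \<open>F\<close>, a plane that contains 1 has dimension at most one. This
  supplies the hypotheses \<open>X\<close> and \<open>Y\<close> of
  \<open>rank3_anisotropic\<close>.\<close>

lemma relation_mod_F:
  assumes "1 \<in> comb2 F u v" "s \<in> comb2 F u v" "t \<in> comb2 F u v"
  obtains a b c where "a \<in> F" "b \<in> F" "c \<in> F" "b \<noteq> 0 \<or> c \<noteq> 0" "b * s + c * t = a"
proof -
  obtain a b c where *: "a \<in> F" "b \<in> F" "c \<in> F" "a \<noteq> 0 \<or> b \<noteq> 0 \<or> c \<noteq> 0" "a * 1 + b * s + c * t = 0"
    using dependent3[OF assms] unfolding indep3_def by blast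
  from *(5) have "b * s + c * t = a" by (metis add.assoc add_eq_0_iff mult_1_right uminus_eq)
  moreover from * this have "b \<noteq> 0 \<or> c \<noteq> 0" by auto
  ultimately show ?thesis using that * by blast
qed

text \<open>
  Let \<open>f\<close> be the linear map with \<open>1 \<mapsto> 0\<close>, \<open>x \<mapsto> - \<gamma> y\<close>, \<open>y \<mapsto> \<alpha> x + \<beta> y\<close>, and let \<open>X\<close>, \<open>Y\<close> have coordinates \<open>c\<close>, \<open>d\<close>.
  If \<open>f(X) - m X = a\<close> and \<open>f(Y) - m Y = b\<close> are in \<open>F\<close>, then \<open>Y f(X) - X f(Y) = a Y - b X\<close>. The left-hand side is linear in
  \<open>s = c \<times> d\<close>, and the scalar product of the coordinates of the right-hand side with \<open>s\<close> is zero.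
\<close>

lemma rank3_anisotropic:
  fixes x y \<alpha> \<beta> \<gamma> :: 'a
  assumes ind: "indep3 F 1 x y" and co: "\<alpha> \<in> F" "\<beta> \<in> F" "\<gamma> \<in> F"
    and aniso: "\<forall>s\<in>F. \<forall>t\<in>F. \<alpha> * s * s + \<beta> * s * t + \<gamma> * t * t = 0 \<longrightarrow> s = 0 \<and> t = 0"
    and out: "\<alpha> * x * x + \<beta> * x * y + \<gamma> * y * y \<notin> comb3 F 1 x y"
    and c: "c1 \<in> F" "c2 \<in> F" "c3 \<in> F" and d: "d1 \<in> F" "d2 \<in> F" "d3 \<in> F" and ab: "a \<in> F" "b \<in> F"
    and X: "c1 * (- m) + c2 * (- \<gamma> * y - m * x) + c3 * (\<alpha> * x + \<beta> * y - m * y) = a"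
    and Y: "d1 * (- m) + d2 * (- \<gamma> * y - m * x) + d3 * (\<alpha> * x + \<beta> * y - m * y) = b"
  shows "c2 * d3 - c3 * d2 = 0 \<and> c3 * d1 - c1 * d3 = 0 \<and> c1 * d2 - c2 * d1 = 0"
proof -
  define s1 s2 s3 where s: "s1 = c2 * d3 - c3 * d2" "s2 = c3 * d1 - c1 * d3" "s3 = c1 * d2 - c2 * d1"
  let ?Q = "\<alpha> * x * x + \<beta> * x * y + \<gamma> * y * y"
  have sF: "s1 \<in> F" "s2 \<in> F" "s3 \<in> F" by (auto simp: s c d simp del: uminus_eq)
  have eq: "s2 * (\<alpha> * x + \<beta> * y) + s3 * (\<gamma> * y) - s1 * ?Q =
      (a * d1 - b * c1) + (a * d2 - b * c2) * x + (a * d3 - b * c3) * y"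
    unfolding X[symmetric] Y[symmetric] s by (simp add: algebra_simps del: uminus_eq two_eq_0 double)
  \<comment> \<open>All terms of \<open>eq\<close> other than \<open>s1 * ?Q\<close> lie in the span
    of 1, \<open>x\<close>, \<open>y\<close>, so an invertible \<open>s1\<close> would put
    \<open>?Q\<close> there.\<close>
  have "s1 = 0"
  proof (rule ccontr)
    assume s1: "s1 \<noteq> 0"
    let ?T = "comb3 F 1 x y"
    have "s1 * ?Q = (b * c1 - a * d1) * 1 + (s2 * \<alpha> - (a * d2 - b * c2)) * x +
        (s2 * \<beta> + s3 * \<gamma> - (a * d3 - b * c3)) * y"
      using eq by (simp add: algebra_simps del: uminus_eq two_eq_0 double)
    moreover have "b * c1 - a * d1 \<in> F" "s2 * \<alpha> - (a * d2 - b * c2) \<in> F"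
      "s2 * \<beta> + s3 * \<gamma> - (a * d3 - b * c3) \<in> F"
      using sF co c d ab by auto
    ultimately have "s1 * ?Q \<in> ?T" unfolding comb3_def by blast
    then have "inverse s1 * (s1 * ?Q) \<in> ?T" using sF by (intro comb3_scale[of "s1 * ?Q"]) auto
    then show False using out s1 by (simp add: mult.assoc[symmetric])
  qed
  have "(b * c1 - a * d1) * 1 + (s2 * \<alpha> - (a * d2 - b * c2)) * x +
        (s2 * \<beta> + s3 * \<gamma> - (a * d3 - b * c3)) * y = 0"
    using eq unfolding \<open>s1 = 0\<close> by (simp add: algebra_simps del: uminus_eq two_eq_0 double)
  then have "b * c1 - a * d1 = 0 \<and> s2 * \<alpha> - (a * d2 - b * c2) = 0 \<and> s2 * \<beta> + s3 * \<gamma> - (a * d3 - b * c3) = 0"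
    by (rule indep3D[OF ind]) (use sF co c d ab in simp_all)
  then have 23: "s2 * \<alpha> = a * d2 - b * c2" "s2 * \<beta> + s3 * \<gamma> = a * d3 - b * c3"
    by simp_all
  have "\<alpha> * s2 * s2 + \<beta> * s2 * s3 + \<gamma> * s3 * s3 = s2 * (s2 * \<alpha>) + s3 * (s2 * \<beta> + s3 * \<gamma>)"
    by (simp add: algebra_simps)
  \<comment> \<open>The vanishing terms with \<open>s1\<close> are put back, so that both brackets
    become scalar products of a cross product with one of its factors.\<close>
  also have "\<dots> = a * (s1 * d1 + s2 * d2 + s3 * d3) - b * (s1 * c1 + s2 * c2 + s3 * c3)"
    unfolding 23 \<open>s1 = 0\<close> by (simp add: algebra_simps del: uminus_eq two_eq_0 double)
  also have "\<dots> = 0"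
    by (simp add: s algebra_simps del: uminus_eq two_eq_0 double)
  finally have "s2 = 0 \<and> s3 = 0" using aniso sF by blast
  with \<open>s1 = 0\<close> show ?thesis by (simp add: s)
qed

text \<open>The witness is \<open>(0, - \<gamma> * y, \<alpha> * x + \<beta> * y, 1)\<close>. Its
  last entry meets the entry 0 of the code, so the plane contains 1 whatever \<open>m\<close> is.
  The other three entries then satisfy two relations modulo \<open>F\<close> with non-proportional
  coefficients, against \<open>rank3_anisotropic\<close>.\<close>

lemma deep_coset_rank3_anisotropic:
  fixes x y \<alpha> \<beta> \<gamma> :: 'a
  assumes E: "x \<in> E" "y \<in> E" and ind: "indep3 F 1 x y" and co: "\<alpha> \<in> F" "\<beta> \<in> F" "\<gamma> \<in> F"
    and aniso: "\<forall>s\<in>F. \<forall>t\<in>F. \<alpha> * s * s + \<beta> * s * t + \<gamma> * t * t = 0 \<longrightarrow> s = 0 \<and> t = 0"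
    and out: "\<alpha> * x * x + \<beta> * x * y + \<gamma> * y * y \<notin> comb3 F 1 x y"
  shows "deep_coset F E 1 x y 0"
  unfolding deep_coset_def
proof (intro bexI allI notI)
  fix m u v
  let ?L = "comb2 F u v"
  let ?d1 = "- m" and ?d2 = "- \<gamma> * y - m * x" and ?d3 = "\<alpha> * x + \<beta> * y - m * y"
  assume "0 - m * 1 \<in> ?L \<and> ?d2 \<in> ?L \<and> ?d3 \<in> ?L \<and> 1 - m * 0 \<in> ?L"
  then have L: "?d1 \<in> ?L" "?d2 \<in> ?L" "?d3 \<in> ?L" "1 \<in> ?L" by simp_all
  note key = rank3_anisotropic[OF ind co aniso out]
  obtain a c1 c2 where c: "a \<in> F" "c1 \<in> F" "c2 \<in> F" "c1 \<noteq> 0 \<or> c2 \<noteq> 0" "c1 * ?d1 + c2 * ?d2 = a"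
    using relation_mod_F[OF L(4,1,2)] by metis
  have c': "c1 * ?d1 + c2 * ?d2 + 0 * ?d3 = a" using c(5) by simp
  \<comment> \<open>The second relation is chosen to omit an entry whose coefficient in the first
    one is nonzero, so the coefficient vectors are not proportional.\<close>
  show False
  proof (cases "c1 = 0")
    case False
    obtain b e2 e3 where e: "b \<in> F" "e2 \<in> F" "e3 \<in> F" "e2 \<noteq> 0 \<or> e3 \<noteq> 0" "e2 * ?d2 + e3 * ?d3 = b"
      using relation_mod_F[OF L(4,2,3)] by metis
    have e': "0 * ?d1 + e2 * ?d2 + e3 * ?d3 = b" using e(5) by simp
    show False using key[OF _ _ _ _ _ _ _ _ c' e'] c e False by auto
  next
    case True
    with c have c2: "c2 \<noteq> 0" by simp
    obtain b e1 e3 where e: "b \<in> F" "e1 \<in> F" "e3 \<in> F" "e1 \<noteq> 0 \<or> e3 \<noteq> 0" "e1 * ?d1 + e3 * ?d3 = b"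
      using relation_mod_F[OF L(4,1,3)] by metis
    have e': "e1 * ?d1 + 0 * ?d2 + e3 * ?d3 = b" using e(5) by simp
    show False using key[OF _ _ _ _ _ _ _ _ c' e'] c e c2 by auto
  qed
qed (use E co in auto)

lemma deep_coset_swap:
  assumes "deep_coset F E g1 g2 g3 g4"
  shows "deep_coset F E g2 g1 g3 g4" "deep_coset F E g1 g3 g2 g4" "deep_coset F E g1 g2 g4 g3"
  using assms unfolding deep_coset_def by blast+

lemma indep3_swap: "indep3 F x y z \<Longrightarrow> indep3 F x z y"
proof -
  assume ind: "indep3 F x y z"
  show ?thesis
    unfolding indep3_def
  proof (intro ballI impI)
    fix a b c assume "a \<in> F" "b \<in> F" "c \<in> F" "a * x + b * z + c * y = 0"
    then show "a = 0 \<and> b = 0 \<and> c = 0"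
      using indep3D[OF ind, of a c b] by (simp add: add_ac)
  qed
qed

text \<open>One of \<open>x * x\<close>, \<open>x * y\<close>, \<open>y * y\<close> is outside the
  span of 1, \<open>x\<close>, \<open>y\<close>. If it is \<open>x * x\<close>, the values of the
  forms for \<open>a\<close> and \<open>b\<close> differ by a nonzero \<open>F\<close>-multiple of
  it, so one of them is outside. The case \<open>y * y\<close> is symmetric. If only
  \<open>x * y\<close> is outside, the form for \<open>a\<close> works.\<close>

lemma deep_coset_rank3:
  assumes E: "x \<in> E" "y \<in> E" and ind: "indep3 F 1 x y"
  shows "deep_coset F E 1 x y 0"
proof -
  obtain a b where ab: "a \<in> F" "b \<in> F" "a \<noteq> b"
    and aniso: "\<forall>c\<in>{a, b}. \<forall>s\<in>F. \<forall>t\<in>F. c * s * s + s * t + t * t = 0 \<longrightarrow> s = 0 \<and> t = 0"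
    using exists_anisotropic by blast
  have case1: "deep_coset F E 1 x y 0" if E: "x \<in> E" "y \<in> E" and ind: "indep3 F 1 x y"
    and c: "c \<in> {a, b}" "c * x * x + x * y + y * y \<notin> comb3 F 1 x y" for x y c
  proof (rule deep_coset_rank3_anisotropic[OF E ind, of c 1 1])
    show "c \<in> F" using c(1) ab by blast
    show "\<forall>s\<in>F. \<forall>t\<in>F. c * s * s + 1 * s * t + 1 * t * t = 0 \<longrightarrow> s = 0 \<and> t = 0"
      using bspec[OF aniso c(1)] by (simp only: mult_1)
    show "c * x * x + 1 * x * y + 1 * y * y \<notin> comb3 F 1 x y"
      using c(2) by (simp only: mult_1 not_False_eq_True)
  qed simp_all
  have case2: "deep_coset F E 1 x y 0" if E: "x \<in> E" "y \<in> E" and ind: "indep3 F 1 x y"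
    and xx: "x * x \<notin> comb3 F 1 x y" for x y
  proof (rule ccontr)
    assume no: "\<not> ?thesis"
    let ?T = "comb3 F 1 x y"
    have "a * x * x + x * y + y * y \<in> ?T" "b * x * x + x * y + y * y \<in> ?T"
      using case1[OF E ind] no by blast+
    then have "1 * (a * x * x + x * y + y * y) + (- 1) * (b * x * x + x * y + y * y) \<in> ?T"
      by (intro comb3_lin) auto
    also have "1 * (a * x * x + x * y + y * y) + (- 1) * (b * x * x + x * y + y * y) = (a - b) * (x * x)"
      by (simp add: algebra_simps del: uminus_eq double)
    finally have "inverse (a - b) * ((a - b) * (x * x)) \<in> ?T" using ab by (intro comb3_scale[of "(a - b) * (x * x)"]) auto
    then show False using xx ab(3) by (simp add: mult.assoc[symmetric] del: uminus_eq)
  qed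
  let ?T = "comb3 F 1 x y"
  consider "x * x \<notin> ?T" | "y * y \<notin> ?T" | "x * x \<in> ?T" "y * y \<in> ?T" "x * y \<notin> ?T"
    using comb3_not_subalgebra[OF ind E(1)] by blast
  then show ?thesis
  proof cases
    case 1
    then show ?thesis by (rule case2[OF E ind])
  next
    case 2
    have "comb3 F 1 y x \<subseteq> ?T"
    proof
      fix t assume "t \<in> comb3 F 1 y x"
      then obtain k l m where "t = k * 1 + l * y + m * x" "k \<in> F" "l \<in> F" "m \<in> F"
        unfolding comb3_def by blast
      moreover from this have "t = k * 1 + m * x + l * y" by (simp add: add_ac)
      ultimately show "t \<in> ?T" unfolding comb3_def by blast
    qed
    with 2 have "deep_coset F E 1 y x 0" using E ind indep3_swap by (intro case2) blast+
    then show ?thesis by (rule deep_coset_swap)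
  next
    case 3
    have "a * x * x + x * y + y * y \<notin> ?T"
    proof
      assume *: "a * x * x + x * y + y * y \<in> ?T"
      have "1 * (a * x * x + x * y + y * y) + 1 * ((- a) * (x * x) + (- 1) * (y * y)) \<in> ?T"
        using 3 ab by (intro comb3_lin[OF *] comb3_lin) auto
      then show False using 3 by (simp add: algebra_simps del: uminus_eq double)
    qed
    then show ?thesis using case1 E ind by blast
  qed
qed

section \<open>Dependent entries: scaling, change of coordinates and small ranks\<close>

lemma comb2_scale: "s \<in> comb2 F u v \<Longrightarrow> t * s \<in> comb2 F (t * u) (t * v)"
proof -
  assume "s \<in> comb2 F u v"
  then obtain a b where "s = a * u + b * v" "a \<in> F" "b \<in> F" by (auto simp: comb2_def)
  then have "t * s = a * (t * u) + b * (t * v)" by (simp add: algebra_simps)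
  with \<open>a \<in> F\<close> \<open>b \<in> F\<close> show ?thesis unfolding comb2_def by blast
qed

lemma deep_coset_scale:
  assumes t: "t \<in> E" "t \<noteq> 0" and d: "deep_coset F E g1 g2 g3 g4"
  shows "deep_coset F E (t * g1) (t * g2) (t * g3) (t * g4)"
proof -
  obtain w1 w2 w3 w4 where w: "w1 \<in> E" "w2 \<in> E" "w3 \<in> E" "w4 \<in> E" and
    no: "\<And>m u v. \<not> (w1 - m * g1 \<in> comb2 F u v \<and> w2 - m * g2 \<in> comb2 F u v \<and>
        w3 - m * g3 \<in> comb2 F u v \<and> w4 - m * g4 \<in> comb2 F u v)"
    using d unfolding deep_coset_def by blast
  have scale: "w - m * g \<in> comb2 F (inverse t * u) (inverse t * v)"
    if "t * w - m * (t * g) \<in> comb2 F u v" for w m g u v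
  proof -
    have "inverse t * (t * w - m * (t * g)) = w - m * g" using t by (simp add: field_simps)
    then show ?thesis using comb2_scale[OF that, of "inverse t"] by simp
  qed
  show ?thesis
    unfolding deep_coset_def
    by (intro bexI[of _ "t * w1"] bexI[of _ "t * w2"] bexI[of _ "t * w3"] bexI[of _ "t * w4"])
      (use no scale in blast, use t w in auto)
qed

text \<open>An invertible change of coordinates over \<open>F\<close> preserves the
  \<open>F\<close>-span of the entries; the same combination is added to the last entry of the code
  and of \<open>w\<close>.\<close>

lemma deep_coset_extend:
  assumes a: "a \<in> F" "b \<in> F" "c \<in> F" and d: "deep_coset F E g1 g2 g3 0"
  shows "deep_coset F E g1 g2 g3 (a * g1 + b * g2 + c * g3)"
proof -
  obtain w1 w2 w3 w4 where w: "w1 \<in> E" "w2 \<in> E" "w3 \<in> E" "w4 \<in> E" and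
    no: "\<And>m u v. \<not> (w1 - m * g1 \<in> comb2 F u v \<and> w2 - m * g2 \<in> comb2 F u v \<and>
        w3 - m * g3 \<in> comb2 F u v \<and> w4 \<in> comb2 F u v)"
    using d unfolding deep_coset_def by auto
  let ?w = "w4 + (a * w1 + b * w2 + c * w3)"
  have "w4 \<in> comb2 F u v"
    if L: "w1 - m * g1 \<in> comb2 F u v" "w2 - m * g2 \<in> comb2 F u v" "w3 - m * g3 \<in> comb2 F u v"
      "?w - m * (a * g1 + b * g2 + c * g3) \<in> comb2 F u v" for m u v
  proof -
    have "1 * (?w - m * (a * g1 + b * g2 + c * g3)) +
        (- 1) * (1 * (a * (w1 - m * g1) + b * (w2 - m * g2)) + c * (w3 - m * g3)) \<in> comb2 F u v"
      using a L by (intro comb2_lin) auto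
    then show ?thesis by (simp add: algebra_simps del: uminus_eq two_eq_0 double)
  qed
  then show ?thesis
    unfolding deep_coset_def
    by (intro bexI[of _ w1] bexI[of _ w2] bexI[of _ w3] bexI[of _ ?w]) (use no in blast, use w a in auto)
qed

text \<open>As \<open>x \<notin> F\<close>, the elements 1 and \<open>x\<close> are a basis of the
  plane.\<close>

lemma comb2_one_cases:
  assumes "x \<notin> F" "1 \<in> comb2 F u v" "x \<in> comb2 F u v" "s \<in> comb2 F u v"
  obtains a b where "a \<in> F" "b \<in> F" "s = a + b * x"
proof -
  obtain a b c where *: "a \<in> F" "b \<in> F" "c \<in> F" "a \<noteq> 0 \<or> b \<noteq> 0 \<or> c \<noteq> 0" "a * 1 + b * x + c * s = 0"
    using dependent3[OF assms(2-4)] unfolding indep3_def by blast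
  have "c \<noteq> 0"
  proof
    assume c: "c = 0"
    with * have "b \<noteq> 0" by auto
    with c *(5) have "x = - a / b" by (simp add: field_simps add_eq_0_iff)
    then show False using assms(1) * by auto
  qed
  with *(5) have "s = (- a / c) + (- b / c) * x"
    by (simp add: field_simps add_eq_0_iff2)
  then show ?thesis using that[of "- a / c" "- b / c"] * by auto
qed

text \<open>For the witness \<open>(0, w, 1, x)\<close> the last two entries do not depend on
  \<open>m\<close> and force the plane to be spanned by 1 and \<open>x\<close>. The first entry puts
  \<open>m\<close> in this plane, and the second puts \<open>w\<close> in the span of 1,
  \<open>x\<close>, \<open>x * x\<close>, which \<open>w\<close> is chosen to avoid.\<close>

lemma deep_coset_rank2:
  assumes E: "x \<in> E" and x: "x \<notin> F"
  shows "deep_coset F E 1 x 0 0"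
proof -
  obtain w where w: "w \<in> E" "w \<notin> comb3 F 1 x (x * x)" using comb3_inside by blast
  show ?thesis
    unfolding deep_coset_def
  proof (intro bexI allI notI)
    fix m u v
    let ?L = "comb2 F u v"
    assume "0 - m * 1 \<in> ?L \<and> w - m * x \<in> ?L \<and> 1 - m * 0 \<in> ?L \<and> x - m * 0 \<in> ?L"
    then have L: "- m \<in> ?L" "w - m * x \<in> ?L" "1 \<in> ?L" "x \<in> ?L" by simp_all
    obtain a b where ab: "a \<in> F" "b \<in> F" "- m = a + b * x"
      using comb2_one_cases[OF x L(3,4,1)] by blast
    obtain c d where cd: "c \<in> F" "d \<in> F" "w - m * x = c + d * x"
      using comb2_one_cases[OF x L(3,4,2)] by blast
    have "w = c + d * x - (- m) * x" using cd by (simp add: algebra_simps del: uminus_eq)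
    also have "\<dots> = c * 1 + (d - a) * x + (- b) * (x * x)"
      unfolding ab(3) by (simp add: algebra_simps del: uminus_eq)
    also have "\<dots> \<in> comb3 F 1 x (x * x)" using ab cd by (intro comb3I) simp_all
    finally show False using w(2) by simp
  qed (use E w in auto)
qed

lemma exists_indep3: "\<exists>x\<in>E. \<exists>y\<in>E. indep3 F 1 x y"
proof -
  obtain x where x: "x \<in> E" "x \<notin> comb3 F 1 0 0" using comb3_inside by blast
  obtain y where y: "y \<in> E" "y \<notin> comb3 F 1 x 0" using comb3_inside by blast
  have "indep3 F 1 x y"
    unfolding indep3_def
  proof (intro ballI impI)
    fix a b c assume abc: "a \<in> F" "b \<in> F" "c \<in> F" "a * 1 + b * x + c * y = 0"
    have "c = 0"
    proof (rule ccontr)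
      assume "c \<noteq> 0"
      then have "y = (- a / c) * 1 + (- b / c) * x + 0 * 0"
        using abc(4) by (simp add: field_simps add_eq_0_iff2)
      moreover have "- a / c \<in> F" "- b / c \<in> F" "0 \<in> F" using abc by auto
      ultimately show False using y(2) unfolding comb3_def by blast
    qed
    moreover have "b = 0"
    proof (rule ccontr)
      assume "b \<noteq> 0"
      then have "x = (- a / b) * 1 + 0 * 0 + 0 * 0"
        using abc(4) \<open>c = 0\<close> by (simp add: field_simps add_eq_0_iff2)
      moreover have "- a / b \<in> F" "0 \<in> F" using abc by auto
      ultimately show False using x(2) unfolding comb3_def by blast
    qed
    ultimately show "a = 0 \<and> b = 0 \<and> c = 0" using abc(4) by simp
  qed
  then show ?thesis using x y by blast
qed

text \<open>Three independent elements are placed where the code is zero, so no \<open>m\<close> can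
  change them.\<close>

lemma deep_coset_rank1: "deep_coset F E g 0 0 0"
proof -
  obtain x y where xy: "x \<in> E" "y \<in> E" "indep3 F 1 x y" using exists_indep3 by blast
  show ?thesis
    unfolding deep_coset_def
    by (intro bexI[of _ 0] bexI[of _ 1] bexI[of _ x] bexI[of _ y]) (use dependent3 xy in auto)
qed

lemma deep_coset_two_generators:
  assumes E: "g1 \<in> E" "g2 \<in> E"
  shows "deep_coset F E g1 g2 0 0"
proof (cases "g1 = 0")
  case True
  then show ?thesis using deep_coset_swap(1)[OF deep_coset_rank1] by simp
next
  case g1: False
  show ?thesis
  proof (cases "g2 / g1 \<in> F")
    case True
    have "deep_coset F E g1 0 0 (g2 / g1 * g1 + 0 * 0 + 0 * 0)"
      by (rule deep_coset_extend[OF True]) (auto intro: deep_coset_rank1)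
    then have "deep_coset F E g1 0 0 g2" using g1 by simp
    then show ?thesis by (rule deep_coset_swap(2)[OF deep_coset_swap(3)])
  next
    case False
    have "deep_coset F E (g1 * 1) (g1 * (g2 / g1)) (g1 * 0) (g1 * 0)"
      using E g1 False by (intro deep_coset_scale deep_coset_rank2) auto
    then show ?thesis using g1 by simp
  qed
qed

text \<open>Independent generators are divided by \<open>g1\<close> to reach
  \<open>deep_coset_rank3\<close>. Otherwise a generator with nonzero coefficient in a relation is
  moved to the end and removed by \<open>deep_coset_extend\<close>.\<close>

lemma deep_coset_three_generators:
  assumes E: "g1 \<in> E" "g2 \<in> E" "g3 \<in> E"
  shows "deep_coset F E g1 g2 g3 0"
proof (cases "indep3 F g1 g2 g3")
  case True
  have g1: "g1 \<noteq> 0"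
  proof
    assume "g1 = 0"
    then have "1 * g1 + 0 * g2 + 0 * g3 = 0" by simp
    then show False using indep3D[OF True, of 1 0 0] by simp
  qed
  have "indep3 F 1 (g2 / g1) (g3 / g1)"
    unfolding indep3_def
  proof (intro ballI impI)
    fix a b c assume F: "a \<in> F" "b \<in> F" "c \<in> F" and "a * 1 + b * (g2 / g1) + c * (g3 / g1) = 0"
    then have "a * g1 + b * g2 + c * g3 = 0" using g1 by (simp add: field_simps)
    then show "a = 0 \<and> b = 0 \<and> c = 0" by (rule indep3D[OF True]) (use F in auto)
  qed
  then have "deep_coset F E (g1 * 1) (g1 * (g2 / g1)) (g1 * (g3 / g1)) (g1 * 0)"
    using E g1 by (intro deep_coset_scale deep_coset_rank3) auto
  then show ?thesis using g1 by simp
next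
  case False
  then obtain a b c where abc: "a \<in> F" "b \<in> F" "c \<in> F" "a * g1 + b * g2 + c * g3 = 0"
    "a \<noteq> 0 \<or> b \<noteq> 0 \<or> c \<noteq> 0"
    unfolding indep3_def by blast
  have step: "deep_coset F E x y z 0" if "x \<in> E" "y \<in> E" "a \<in> F" "b \<in> F" "c \<in> F" "c \<noteq> 0"
    "a * x + b * y + c * z = 0" for a b c x y z
  proof -
    have "deep_coset F E x y 0 ((- a / c) * x + (- b / c) * y + 0 * 0)"
      using that by (intro deep_coset_extend deep_coset_two_generators) auto
    also have "(- a / c) * x + (- b / c) * y + 0 * 0 = z"
      using that(6,7) by (simp add: field_simps add_eq_0_iff2)
    finally show ?thesis by (rule deep_coset_swap)
  qed
  have "c \<noteq> 0 \<Longrightarrow> deep_coset F E g1 g2 g3 0"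
    using step[of g1 g2 a b c g3] abc E by simp
  moreover have "b \<noteq> 0 \<Longrightarrow> deep_coset F E g1 g3 g2 0"
    using step[of g1 g3 a c b g2] abc E by (simp add: add_ac)
  moreover have "a \<noteq> 0 \<Longrightarrow> deep_coset F E g2 g3 g1 0"
    using step[of g2 g3 b c a g1] abc E by (simp add: add_ac)
  ultimately show ?thesis
    using abc(5) deep_coset_swap(2)[of g1 g3 g2 0]
      deep_coset_swap(1)[OF deep_coset_swap(2), of g2 g3 g1 0] by argo
qed

text \<open>The dependent case again solves a relation for one generator, which leaves
  three.\<close>

theorem deep_coset:
  assumes E: "g1 \<in> E" "g2 \<in> E" "g3 \<in> E" "g4 \<in> E"
  shows "deep_coset F E g1 g2 g3 g4"
proof (cases "indep4 F g1 g2 g3 g4")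
  case True
  then show ?thesis by (rule deep_coset_rank4[OF E])
next
  case False
  then obtain a b c d where F: "a \<in> F" "b \<in> F" "c \<in> F" "d \<in> F"
    and eq: "a * g1 + b * g2 + c * g3 + d * g4 = 0" and nz: "a \<noteq> 0 \<or> b \<noteq> 0 \<or> c \<noteq> 0 \<or> d \<noteq> 0"
    unfolding indep4_def by blast
  have step: "deep_coset F E x y z t" if "x \<in> E" "y \<in> E" "z \<in> E" "a \<in> F" "b \<in> F" "c \<in> F" "d \<in> F" "d \<noteq> 0"
    "a * x + b * y + c * z + d * t = 0" for a b c d x y z t
  proof -
    have "deep_coset F E x y z ((- a / d) * x + (- b / d) * y + (- c / d) * z)"
      using that by (intro deep_coset_extend deep_coset_three_generators) auto
    also have "(- a / d) * x + (- b / d) * y + (- c / d) * z = t"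
      using that(8,9) by (simp add: field_simps add_eq_0_iff2)
    finally show ?thesis .
  qed
  have "d \<noteq> 0 \<Longrightarrow> deep_coset F E g1 g2 g3 g4"
    using step[of g1 g2 g3 a b c d g4] F E eq by simp
  moreover have "c \<noteq> 0 \<Longrightarrow> deep_coset F E g1 g2 g4 g3"
    using step[of g1 g2 g4 a b d c g3] F E eq by (simp add: add_ac)
  moreover have "b \<noteq> 0 \<Longrightarrow> deep_coset F E g1 g3 g4 g2"
    using step[of g1 g3 g4 a c d b g2] F E eq by (simp add: add_ac)
  moreover have "a \<noteq> 0 \<Longrightarrow> deep_coset F E g2 g3 g4 g1"
    using step[of g2 g3 g4 b c d a g1] F E eq by (simp add: add_ac)
  ultimately show ?thesis
    using nz deep_coset_swap(3)[of g1 g2 g4 g3] deep_coset_swap(2)[OF deep_coset_swap(3), of g1 g3 g4 g2]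
      deep_coset_swap(1)[OF deep_coset_swap(2)[OF deep_coset_swap(3)], of g2 g3 g4 g1] by argo
qed

section \<open>The lower bound\<close>

text \<open>Here \<open>u\<close> and \<open>w\<close> are the scalars of a combination of two
  vectors of the \<open>F\<close>-span of the generators: expanding both vectors and collecting
  terms gives each generator a coefficient in the plane \<open>comb2 F u w\<close>.\<close>

definition covered :: "(nat \<Rightarrow> 'a) \<Rightarrow> (nat \<Rightarrow> 'a) \<Rightarrow> (nat \<Rightarrow> 'a) \<Rightarrow> (nat \<Rightarrow> 'a) \<Rightarrow> (nat \<Rightarrow> 'a) \<Rightarrow> bool" where
  "covered h1 h2 h3 h4 v \<longleftrightarrow> (\<exists>u\<in>E. \<exists>w\<in>E. \<exists>m1\<in>comb2 F u w. \<exists>m2\<in>comb2 F u w. \<exists>m3\<in>comb2 F u w. \<exists>m4\<in>comb2 F u w.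
     \<forall>i<3. v i = m1 * h1 i + m2 * h2 i + m3 * h3 i + m4 * h4 i)"

lemma coveredI:
  "u \<in> E \<Longrightarrow> w \<in> E \<Longrightarrow> m1 \<in> comb2 F u w \<Longrightarrow> m2 \<in> comb2 F u w \<Longrightarrow> m3 \<in> comb2 F u w \<Longrightarrow> m4 \<in> comb2 F u w \<Longrightarrow>
     (\<And>i. i < 3 \<Longrightarrow> v i = m1 * h1 i + m2 * h2 i + m3 * h3 i + m4 * h4 i) \<Longrightarrow> covered h1 h2 h3 h4 v"
  unfolding covered_def by blast

lemma coveredE:
  assumes "covered h1 h2 h3 h4 v"
  obtains u w m1 m2 m3 m4 where "u \<in> E" "w \<in> E" "m1 \<in> comb2 F u w" "m2 \<in> comb2 F u w" "m3 \<in> comb2 F u w"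
    "m4 \<in> comb2 F u w" "\<And>i. i < 3 \<Longrightarrow> v i = m1 * h1 i + m2 * h2 i + m3 * h3 i + m4 * h4 i"
  using assms unfolding covered_def by blast

lemma covered_swap:
  assumes "covered h1 h2 h3 h4 v"
  shows "covered h2 h1 h3 h4 v" "covered h1 h3 h2 h4 v" "covered h1 h2 h4 h3 v"
proof -
  obtain u w m1 m2 m3 m4 where m: "u \<in> E" "w \<in> E" "m1 \<in> comb2 F u w" "m2 \<in> comb2 F u w" "m3 \<in> comb2 F u w"
    "m4 \<in> comb2 F u w" and v: "\<And>i. i < 3 \<Longrightarrow> v i = m1 * h1 i + m2 * h2 i + m3 * h3 i + m4 * h4 i"
    using assms by (rule coveredE) blast
  show "covered h2 h1 h3 h4 v"
    by (rule coveredI[OF m(1,2) m(4,3,5,6)]) (simp add: v add_ac)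
  show "covered h1 h3 h2 h4 v"
    by (rule coveredI[OF m(1,2) m(3,5,4,6)]) (simp add: v add_ac)
  show "covered h1 h2 h4 h3 v"
    by (rule coveredI[OF m(1,2) m(3,4,6,5)]) (simp add: v add_ac)
qed

lemma comb2_E: "u \<in> E \<Longrightarrow> w \<in> E \<Longrightarrow> m \<in> comb2 F u w \<Longrightarrow> m \<in> E"
  by (auto simp: comb2_def)

text \<open>If \<open>h1\<close>, \<open>h2\<close>, \<open>h3\<close> do not generate the whole
  space, any vector outside their span is uncovered, since \<open>h4\<close> lies in that span. If
  they do, equal cardinalities make \<open>\<phi>\<close> injective, so they form a basis; the
  relations are then the multiples of \<open>(c1, c2, c3, - 1)\<close>, and
  \<open>deep_coset\<close> applies to this vector.\<close>

lemma uncovered_aux: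
  assumes h: "\<And>i. i < 3 \<Longrightarrow> h1 i \<in> E" "\<And>i. i < 3 \<Longrightarrow> h2 i \<in> E" "\<And>i. i < 3 \<Longrightarrow> h3 i \<in> E"
    and c: "c1 \<in> E" "c2 \<in> E" "c3 \<in> E" and h4: "\<And>i. i < 3 \<Longrightarrow> h4 i = c1 * h1 i + c2 * h2 i + c3 * h3 i"
  shows "\<exists>v. (\<forall>i<3. v i \<in> E) \<and> \<not> covered h1 h2 h3 h4 v"
proof -
  let ?V = "{..<3::nat} \<rightarrow>\<^sub>E E"
  define \<phi> where "\<phi> = (\<lambda>(x, y, z). \<lambda>i\<in>{..<3::nat}. x * h1 i + y * h2 i + z * h3 i)"
  have im: "\<phi> ` (E \<times> E \<times> E) \<subseteq> ?V" using h by (auto simp: \<phi>_def split: if_splits)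
  have cardV: "card ?V = card (E \<times> E \<times> E)"
    by (simp add: card_PiE card_cartesian_product prod_constant power3_eq_cube)
  have finV: "finite ?V" by (intro finite_PiE) auto
  show ?thesis
  proof (cases "?V \<subseteq> \<phi> ` (E \<times> E \<times> E)")
    case False
    then obtain v where v: "v \<in> ?V" "v \<notin> \<phi> ` (E \<times> E \<times> E)" by blast
    have "\<not> covered h1 h2 h3 h4 v"
    proof
      assume "covered h1 h2 h3 h4 v"
      then obtain u w m1 m2 m3 m4 where m: "u \<in> E" "w \<in> E" "m1 \<in> comb2 F u w" "m2 \<in> comb2 F u w" "m3 \<in> comb2 F u w"
         "m4 \<in> comb2 F u w" and eq: "\<And>i. i < 3 \<Longrightarrow> v i = m1 * h1 i + m2 * h2 i + m3 * h3 i + m4 * h4 i"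
        by (rule coveredE) blast
      have "v = \<phi> (m1 + m4 * c1, m2 + m4 * c2, m3 + m4 * c3)"
      proof
        fix i show "v i = \<phi> (m1 + m4 * c1, m2 + m4 * c2, m3 + m4 * c3) i"
          using PiE_arb[OF v(1), of i] eq[of i] h4[of i] by (cases "i < 3") (simp_all add: \<phi>_def algebra_simps)
      qed
      moreover have "(m1 + m4 * c1, m2 + m4 * c2, m3 + m4 * c3) \<in> E \<times> E \<times> E"
        using m(3-6)[THEN comb2_E[OF m(1,2)]] c by simp
      ultimately show False using v(2) by blast
    qed
    moreover have "\<forall>i<3. v i \<in> E" using v(1) by auto
    ultimately show ?thesis by blast
  next
    case True
    then have "inj_on \<phi> (E \<times> E \<times> E)"
      using im cardV by (intro eq_card_imp_inj_on) (auto dest: equalityI)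
    obtain w1 w2 w3 w4 where w: "w1 \<in> E" "w2 \<in> E" "w3 \<in> E" "w4 \<in> E" and
      no: "\<And>m u v. \<not> (w1 - m * c1 \<in> comb2 F u v \<and> w2 - m * c2 \<in> comb2 F u v \<and>
        w3 - m * c3 \<in> comb2 F u v \<and> w4 - m * (- 1) \<in> comb2 F u v)"
      using deep_coset[of c1 c2 c3 "- 1"] c unfolding deep_coset_def by (auto simp del: uminus_eq)
    define v where "v = (\<lambda>i. w1 * h1 i + w2 * h2 i + w3 * h3 i + w4 * h4 i)"
    have "\<not> covered h1 h2 h3 h4 v"
    proof
      assume "covered h1 h2 h3 h4 v"
      then obtain u w m1 m2 m3 m4 where m: "u \<in> E" "w \<in> E" "m1 \<in> comb2 F u w" "m2 \<in> comb2 F u w" "m3 \<in> comb2 F u w"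
         "m4 \<in> comb2 F u w" and eq: "\<And>i. i < 3 \<Longrightarrow> v i = m1 * h1 i + m2 * h2 i + m3 * h3 i + m4 * h4 i"
        by (rule coveredE) blast
      have mE: "m1 \<in> E" "m2 \<in> E" "m3 \<in> E" "m4 \<in> E" using m(3-6)[THEN comb2_E[OF m(1,2)]] by blast+
      let ?x = "(m1 + m4 * c1, m2 + m4 * c2, m3 + m4 * c3)" and ?y = "(w1 + w4 * c1, w2 + w4 * c2, w3 + w4 * c3)"
      have "\<phi> ?x = \<phi> ?y"
      proof
        fix i show "\<phi> ?x i = \<phi> ?y i"
          using eq[of i] h4[of i] by (cases "i < 3") (simp_all add: \<phi>_def v_def algebra_simps)
      qed
      then have "?x = ?y"
        using inj_onD[OF \<open>inj_on \<phi> (E \<times> E \<times> E)\<close>, of ?x ?y] mE w c by simp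
      \<comment> \<open>Two coefficient vectors of \<open>v\<close> differ by a relation; the last
        coordinate shows that its factor is \<open>m4 - w4\<close>.\<close>
      then have "w1 - (m4 - w4) * c1 = m1" "w2 - (m4 - w4) * c2 = m2" "w3 - (m4 - w4) * c3 = m3"
        "w4 - (m4 - w4) * (- 1) = m4"
        by (simp_all only: prod.inject) (simp_all add: algebra_simps del: uminus_eq double)
      then show False using no[of "m4 - w4" u w] m by simp
    qed
    moreover have "\<forall>i<3. v i \<in> E" using w h h4 c by (auto simp: v_def)
    ultimately show ?thesis by blast
  qed
qed

text \<open>There are more coefficient quadruples than vectors, so the generators satisfy a
  nontrivial relation over \<open>E\<close>. One with nonzero coefficient is moved to the end, where
  \<open>uncovered_aux\<close> applies.\<close>

lemma uncovered:
  assumes h: "\<And>i. i < 3 \<Longrightarrow> h1 i \<in> E" "\<And>i. i < 3 \<Longrightarrow> h2 i \<in> E" "\<And>i. i < 3 \<Longrightarrow> h3 i \<in> E" "\<And>i. i < 3 \<Longrightarrow> h4 i \<in> E"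
  shows "\<exists>v. (\<forall>i<3. v i \<in> E) \<and> \<not> covered h1 h2 h3 h4 v"
proof -
  let ?V = "{..<3::nat} \<rightarrow>\<^sub>E E"
  define \<phi> where "\<phi> = (\<lambda>(x, y, z, t). \<lambda>i\<in>{..<3::nat}. x * h1 i + y * h2 i + z * h3 i + t * h4 i)"
  have "\<phi> ` (E \<times> E \<times> E \<times> E) \<subseteq> ?V" using h by (auto simp: \<phi>_def split: if_splits)
  then have "card (\<phi> ` (E \<times> E \<times> E \<times> E)) \<le> card ?V"
    by (intro card_mono finite_PiE) auto
  also have "\<dots> < card (E \<times> E \<times> E \<times> E)"
    using power_strict_increasing[of 0 4 q] q4
    by (simp add: card_PiE card_cartesian_product prod_constant power3_eq_cube card_E)
  finally have "\<not> inj_on \<phi> (E \<times> E \<times> E \<times> E)" by (rule pigeonhole)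
  then obtain s t where st: "s \<in> E \<times> E \<times> E \<times> E" "t \<in> E \<times> E \<times> E \<times> E" "\<phi> s = \<phi> t" "s \<noteq> t"
    unfolding inj_on_def by meson
  obtain x1 x2 x3 x4 y1 y2 y3 y4 where e: "s = (x1, x2, x3, x4)" "t = (y1, y2, y3, y4)"
    by (metis prod_cases4)
  have xy: "x1 \<in> E" "x2 \<in> E" "x3 \<in> E" "x4 \<in> E" "y1 \<in> E" "y2 \<in> E" "y3 \<in> E" "y4 \<in> E"
    "\<phi> (x1, x2, x3, x4) = \<phi> (y1, y2, y3, y4)"
    and ne: "x1 \<noteq> y1 \<or> x2 \<noteq> y2 \<or> x3 \<noteq> y3 \<or> x4 \<noteq> y4"
    using st unfolding e by simp_all
  define a b c d where "a = x1 - y1" "b = x2 - y2" "c = x3 - y3" "d = x4 - y4"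
  note abcd = this
  have E: "a \<in> E" "b \<in> E" "c \<in> E" "d \<in> E" using xy by (simp_all add: abcd)
  have rel: "a * h1 i + b * h2 i + c * h3 i + d * h4 i = 0" if "i < 3" for i
  proof -
    have "\<phi> (x1, x2, x3, x4) i = \<phi> (y1, y2, y3, y4) i" using xy by simp
    then show ?thesis using that by (simp add: \<phi>_def abcd algebra_simps del: uminus_eq double)
  qed
  have step: "\<exists>v. (\<forall>i<3. v i \<in> E) \<and> \<not> covered h1 h2 h3 h4 v"
    if "\<And>i. i < 3 \<Longrightarrow> h1 i \<in> E" "\<And>i. i < 3 \<Longrightarrow> h2 i \<in> E" "\<And>i. i < 3 \<Longrightarrow> h3 i \<in> E"
      and E: "a \<in> E" "b \<in> E" "c \<in> E" "d \<in> E" "d \<noteq> 0"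
      and rel: "\<And>i. i < 3 \<Longrightarrow> a * h1 i + b * h2 i + c * h3 i + d * h4 i = 0" for a b c d h1 h2 h3 h4
  proof (rule uncovered_aux[OF that(1-3), where ?c1.0 = "- a / d" and ?c2.0 = "- b / d" and ?c3.0 = "- c / d"])
    fix i :: nat assume "i < 3"
    from rel[OF this] show "h4 i = (- a / d) * h1 i + (- b / d) * h2 i + (- c / d) * h3 i"
      using E(5) by (simp add: field_simps add_eq_0_iff2)
  qed (use E in auto)
  consider "d \<noteq> 0" | "c \<noteq> 0" | "b \<noteq> 0" | "a \<noteq> 0" using ne by (auto simp: abcd simp del: uminus_eq)
  then show ?thesis
  proof cases
    case 1
    show ?thesis by (rule step[OF h(1-3) E 1 rel])
  next
    case 2
    have "\<exists>v. (\<forall>i<3. v i \<in> E) \<and> \<not> covered h1 h2 h4 h3 v"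
      by (rule step[OF h(1,2,4) E(1,2,4,3) 2]) (use rel in \<open>simp_all add: add_ac\<close>)
    then show ?thesis using covered_swap(3) by blast
  next
    case 3
    have "\<exists>v. (\<forall>i<3. v i \<in> E) \<and> \<not> covered h1 h3 h4 h2 v"
      by (rule step[OF h(1,3,4) E(1,3,4,2) 3]) (use rel in \<open>simp_all add: add_ac\<close>)
    then show ?thesis using covered_swap(3)[OF covered_swap(2)] by blast
  next
    case 4
    have "\<exists>v. (\<forall>i<3. v i \<in> E) \<and> \<not> covered h2 h3 h4 h1 v"
      by (rule step[OF h(2,3,4) E(2,3,4,1) 4]) (use rel in \<open>simp_all add: add_ac\<close>)
    then show ?thesis using covered_swap(3)[OF covered_swap(2)[OF covered_swap(1)]] by blast
  qed
qed

section \<open>Spans and subspaces in the space \<open>E ^ 3\<close>\<close>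

abbreviation "V \<equiv> tuple_space E 3"

lemma V_simps:
  "carrier V = {v \<in> carrier_vec 3. \<forall>i<3. v $ i \<in> E}" "v \<oplus>\<^bsub>V\<^esub> w = v + w" "c \<odot>\<^bsub>V\<^esub> v = c \<cdot>\<^sub>v v" "\<zero>\<^bsub>V\<^esub> = 0\<^sub>v 3"
  by (simp_all add: tuple_space_def module_vec_simps)

lemma field_on_carrier: "carrier (field_on K) = K"
  by (simp add: field_on_def)

lemma vectorspace_F: "vectorspace (field_on F) V"
  by (rule vectorspace_tuple_space) auto

lemma vectorspace_E: "vectorspace (field_on E) V"
  by (rule vectorspace_tuple_space) auto

lemma module_F: "module (field_on F) V" and module_E: "module (field_on E) V"
  using vectorspace_F vectorspace_E by (simp_all add: vectorspace_def)

lemma submoduleI: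
  assumes "module (field_on K) V" "N \<subseteq> carrier V" "0\<^sub>v 3 \<in> N"
    "\<And>v w. v \<in> N \<Longrightarrow> w \<in> N \<Longrightarrow> v + w \<in> N" "\<And>c v. c \<in> K \<Longrightarrow> v \<in> N \<Longrightarrow> c \<cdot>\<^sub>v v \<in> N"
  shows "submodule (field_on K) N V"
  using assms by (intro submodule.intro) (simp_all add: V_simps(2-) field_on_carrier)

lemma span_over_least:
  assumes "N \<subseteq> carrier V" "0\<^sub>v 3 \<in> N" "S \<subseteq> N"
    "\<And>v w. v \<in> N \<Longrightarrow> w \<in> N \<Longrightarrow> v + w \<in> N" "\<And>c v. c \<in> E \<Longrightarrow> v \<in> N \<Longrightarrow> c \<cdot>\<^sub>v v \<in> N"
  shows "span_over E 3 S \<subseteq> N"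
proof -
  have "submodule (field_on E) N V"
    by (rule submoduleI[OF module_E]) (use assms in simp_all)
  then show ?thesis
    unfolding span_over_def using module.span_is_subset[OF module_E] assms(3) by blast
qed

lemma span_over_superset: "S \<subseteq> carrier V \<Longrightarrow> S \<subseteq> span_over E 3 S"
  unfolding span_over_def by (rule module.in_own_span[OF module_E])

lemma span_over_submodule: "S \<subseteq> carrier V \<Longrightarrow> submodule (field_on E) (span_over E 3 S) V"
  unfolding span_over_def by (rule module.span_is_submodule[OF module_E])

lemma span_over_closed:
  assumes "S \<subseteq> carrier V"
  shows "span_over E 3 S \<subseteq> carrier V" "0\<^sub>v 3 \<in> span_over E 3 S"
    "\<And>v w. v \<in> span_over E 3 S \<Longrightarrow> w \<in> span_over E 3 S \<Longrightarrow> v + w \<in> span_over E 3 S"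
    "\<And>c v. c \<in> E \<Longrightarrow> v \<in> span_over E 3 S \<Longrightarrow> c \<cdot>\<^sub>v v \<in> span_over E 3 S"
proof -
  interpret submodule "field_on E" "span_over E 3 S" V by (rule span_over_submodule[OF assms])
  show "span_over E 3 S \<subseteq> carrier V" by (rule subset)
  show "0\<^sub>v 3 \<in> span_over E 3 S" using zero_closed by (simp only: V_simps)
  show "v + w \<in> span_over E 3 S" if "v \<in> span_over E 3 S" "w \<in> span_over E 3 S" for v w
    using m_closed[OF that] by (simp only: V_simps)
  show "c \<cdot>\<^sub>v v \<in> span_over E 3 S" if "c \<in> E" "v \<in> span_over E 3 S" for c v
    using smult_closed[of c v] that by (simp only: V_simps field_on_carrier)
qed

lemma span_over_singleton: "u \<in> carrier V \<Longrightarrow> span_over E 3 {u} \<subseteq> {c \<cdot>\<^sub>v u | c. c \<in> E}"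
proof (rule span_over_least)
  assume u: "u \<in> carrier V"
  then have [simp]: "u \<in> carrier_vec 3" "dim_vec u = 3" by (simp_all add: V_simps)
  show "{c \<cdot>\<^sub>v u | c. c \<in> E} \<subseteq> carrier V" using u by (auto simp: V_simps)
  show "0\<^sub>v 3 \<in> {c \<cdot>\<^sub>v u | c. c \<in> E}" by (auto intro!: exI[of _ 0])
  show "{u} \<subseteq> {c \<cdot>\<^sub>v u | c. c \<in> E}" by (auto intro!: exI[of _ 1])
  show "v + w \<in> {c \<cdot>\<^sub>v u | c. c \<in> E}" if vw: "v \<in> {c \<cdot>\<^sub>v u | c. c \<in> E}" "w \<in> {c \<cdot>\<^sub>v u | c. c \<in> E}" for v w
  proof -
    obtain c d where "v = c \<cdot>\<^sub>v u" "w = d \<cdot>\<^sub>v u" "c \<in> E" "d \<in> E" using vw by auto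
    then show ?thesis by (auto simp: add_smult_distrib_vec intro!: exI[of _ "c + d"])
  qed
  show "d \<cdot>\<^sub>v v \<in> {c \<cdot>\<^sub>v u | c. c \<in> E}" if dv: "d \<in> E" "v \<in> {c \<cdot>\<^sub>v u | c. c \<in> E}" for d v
  proof -
    obtain c where "v = c \<cdot>\<^sub>v u" "c \<in> E" using dv by auto
    with dv(1) show ?thesis by (auto simp: smult_smult_assoc intro!: exI[of _ "d * c"])
  qed
qed

lemma span_over_pair:
  assumes u: "u \<in> carrier V" "w \<in> carrier V"
  shows "span_over E 3 (span_over E 3 {u} \<union> span_over E 3 {w}) \<subseteq> {c \<cdot>\<^sub>v u + d \<cdot>\<^sub>v w | c d. c \<in> E \<and> d \<in> E}"
    (is "_ \<subseteq> ?N")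
proof (rule span_over_least)
  have [simp]: "u \<in> carrier_vec 3" "w \<in> carrier_vec 3" using u by (simp_all add: V_simps)
  have [simp]: "dim_vec u = 3" "dim_vec w = 3" using u by (simp_all add: V_simps)
  show "?N \<subseteq> carrier V" using u by (auto simp: V_simps)
  have mem: "c \<cdot>\<^sub>v u + d \<cdot>\<^sub>v w \<in> ?N" if "c \<in> E" "d \<in> E" for c d
    using that by blast
  have "0 \<cdot>\<^sub>v u + 0 \<cdot>\<^sub>v w = 0\<^sub>v 3" by auto
  then show "0\<^sub>v 3 \<in> ?N" using mem[of 0 0] by simp
  have "c \<cdot>\<^sub>v u \<in> ?N" if "c \<in> E" for c
  proof -
    have "c \<cdot>\<^sub>v u + 0 \<cdot>\<^sub>v w = c \<cdot>\<^sub>v u" by (intro eq_vecI) auto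
    then show ?thesis using mem[of c 0] that by simp
  qed
  moreover have "c \<cdot>\<^sub>v w \<in> ?N" if "c \<in> E" for c
  proof -
    have "0 \<cdot>\<^sub>v u + c \<cdot>\<^sub>v w = c \<cdot>\<^sub>v w" by (intro eq_vecI) auto
    then show ?thesis using mem[of 0 c] that by simp
  qed
  ultimately show "span_over E 3 {u} \<union> span_over E 3 {w} \<subseteq> ?N"
    using span_over_singleton[OF u(1)] span_over_singleton[OF u(2)] by blast
  show "x + y \<in> ?N" if xy: "x \<in> ?N" "y \<in> ?N" for x y
  proof -
    obtain c d c' d' where *: "x = c \<cdot>\<^sub>v u + d \<cdot>\<^sub>v w" "y = c' \<cdot>\<^sub>v u + d' \<cdot>\<^sub>v w"
      "c \<in> E" "d \<in> E" "c' \<in> E" "d' \<in> E"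
      using xy by blast
    have "x + y = (c + c') \<cdot>\<^sub>v u + (d + d') \<cdot>\<^sub>v w"
      unfolding * by (intro eq_vecI) (auto simp: algebra_simps)
    then show ?thesis using mem[of "c + c'" "d + d'"] * by simp
  qed
  show "e \<cdot>\<^sub>v x \<in> ?N" if ex: "e \<in> E" "x \<in> ?N" for e x
  proof -
    obtain c d where *: "x = c \<cdot>\<^sub>v u + d \<cdot>\<^sub>v w" "c \<in> E" "d \<in> E"
      using ex by blast
    have "e \<cdot>\<^sub>v x = (e * c) \<cdot>\<^sub>v u + (e * d) \<cdot>\<^sub>v w"
      unfolding * by (intro eq_vecI) (auto simp: algebra_simps)
    then show ?thesis using mem[of "e * c" "e * d"] * ex(1) by simp
  qed
qed

lemma subspace_F_facts:
  assumes "VectorSpace.subspace (field_on F) U V"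
  shows "U \<subseteq> carrier V" "0\<^sub>v 3 \<in> U" "\<And>v w. v \<in> U \<Longrightarrow> w \<in> U \<Longrightarrow> v + w \<in> U"
    "\<And>c v. c \<in> F \<Longrightarrow> v \<in> U \<Longrightarrow> c \<cdot>\<^sub>v v \<in> U"
proof -
  interpret submodule "field_on F" U V using assms by (simp add: VectorSpace.subspace_def)
  show "U \<subseteq> carrier V" by (rule subset)
  show "0\<^sub>v 3 \<in> U" using zero_closed by (simp only: V_simps)
  show "v + w \<in> U" if "v \<in> U" "w \<in> U" for v w
    using m_closed[OF that] by (simp only: V_simps)
  show "c \<cdot>\<^sub>v v \<in> U" if "c \<in> F" "v \<in> U" for c v
    using smult_closed[of c v] that by (simp only: V_simps field_on_carrier)
qed

lemma finite_V: "finite (carrier V)"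
proof (rule finite_subset)
  show "carrier V \<subseteq> (\<lambda>f. vec 3 f) ` ({..<3} \<rightarrow>\<^sub>E E)"
  proof
    fix v assume v: "v \<in> carrier V"
    then have "v = vec 3 (\<lambda>i\<in>{..<3}. v $ i)" by (intro eq_vecI) (auto simp: V_simps)
    moreover have "(\<lambda>i\<in>{..<3}. v $ i) \<in> {..<3} \<rightarrow>\<^sub>E E" using v by (auto simp: V_simps)
    ultimately show "v \<in> (\<lambda>f. vec 3 f) ` ({..<3} \<rightarrow>\<^sub>E E)" by (rule image_eqI)
  qed
  show "finite ((\<lambda>f. vec 3 f) ` ({..<3::nat} \<rightarrow>\<^sub>E E))" by (intro finite_imageI finite_PiE) auto
qed

text \<open>The zero vector pads a smaller generating set to exactly four, the number that
  \<open>uncovered\<close> expects.\<close>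

lemma four_generators:
  assumes U: "VectorSpace.subspace (field_on F) U V" and dim: "dim_over E F 3 U \<le> 4"
  obtains h1 h2 h3 h4 where "{h1, h2, h3, h4} \<subseteq> U" "\<And>u. u \<in> U \<Longrightarrow> \<exists>a\<in>F. \<exists>b\<in>F. \<exists>c\<in>F. \<exists>d\<in>F. \<forall>i<3.
    u $ i = a * h1 $ i + b * h2 $ i + c * h3 $ i + d * h4 $ i"
proof -
  note UF = subspace_F_facts[OF U]
  interpret V: vectorspace "field_on F" V by (rule vectorspace_F)
  let ?W = "V\<lparr>carrier := U\<rparr>"
  interpret W: vectorspace "field_on F" ?W by (rule V.subspace_is_vs[OF U])
  have finU: "finite U" using UF(1) finite_V by (rule finite_subset)
  have "W.span U = U"
    using W.in_own_span[of U] W.span_is_subset2[of U] by auto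
  \<comment> \<open>\<open>W.dim\<close> is the least size of a finite generating set. The finite
    set \<open>U\<close> generates itself, so this minimum is attained.\<close>
  then have "\<exists>A. finite A \<and> card A = card U \<and> A \<subseteq> carrier ?W \<and> W.span A = carrier ?W"
    using finU by auto
  then obtain A where A: "finite A" "card A = W.dim" "A \<subseteq> U" "W.span A = U"
    using LeastI[of "\<lambda>n. \<exists>A. finite A \<and> card A = n \<and> A \<subseteq> carrier ?W \<and> W.span A = carrier ?W" "card U"]
    unfolding W.dim_def by auto
  have "card A \<le> 4" using dim A(2) by (simp add: dim_over_def)
  obtain xs where xs: "set xs = A" "length xs = card A"
    using finite_distinct_list[OF A(1)] distinct_card by metis
  let ?h = "\<lambda>i. (xs @ replicate 4 (0\<^sub>v 3)) ! i"
  have hU: "?h i \<in> U" if "i < 4" for i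
    using that xs A(3) UF(2) by (auto simp: nth_append)
  have "A \<subseteq> {?h 0, ?h 1, ?h 2, ?h 3}"
  proof
    fix x assume "x \<in> A"
    then obtain i where i: "i < length xs" "x = xs ! i" using xs by (metis in_set_conv_nth)
    then have "i < 4" using xs \<open>card A \<le> 4\<close> by simp
    then have "i = 0 \<or> i = 1 \<or> i = 2 \<or> i = 3" by auto
    moreover have "x = ?h i" using i by (simp add: nth_append)
    ultimately show "x \<in> {?h 0, ?h 1, ?h 2, ?h 3}" by auto
  qed
  moreover obtain h1 h2 h3 h4 where h: "h1 = ?h 0" "h2 = ?h 1" "h3 = ?h 2" "h4 = ?h 3" by blast
  ultimately have Ah: "A \<subseteq> {h1, h2, h3, h4}" by simp
  have hU': "h1 \<in> U" "h2 \<in> U" "h3 \<in> U" "h4 \<in> U" unfolding h by (rule hU, simp)+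
  have h3: "h1 \<in> carrier_vec 3" "h2 \<in> carrier_vec 3" "h3 \<in> carrier_vec 3" "h4 \<in> carrier_vec 3"
    using hU' UF(1) by (auto simp: V_simps)
  let ?P = "\<lambda>u a b c d. \<forall>i<3. u $ i = a * h1 $ i + b * h2 $ i + c * h3 $ i + d * h4 $ i"
  \<comment> \<open>The vectors of the desired form are a submodule containing \<open>A\<close>,
    hence all of \<open>U\<close>.\<close>
  define N where "N = {u \<in> U. \<exists>a\<in>F. \<exists>b\<in>F. \<exists>c\<in>F. \<exists>d\<in>F. ?P u a b c d}"
  have NI: "u \<in> N" if "u \<in> U" "a \<in> F" "b \<in> F" "c \<in> F" "d \<in> F" "?P u a b c d" for u a b c d
    using that unfolding N_def by blast
  have NE: "\<exists>a b c d. u \<in> U \<and> a \<in> F \<and> b \<in> F \<and> c \<in> F \<and> d \<in> F \<and> ?P u a b c d" if "u \<in> N" for u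
    using that unfolding N_def by blast
  have "submodule (field_on F) N ?W"
  proof (rule submodule.intro)
    show "module (field_on F) ?W" ..
    show "N \<subseteq> carrier ?W" by (auto simp: N_def)
    show "\<zero>\<^bsub>?W\<^esub> \<in> N" using UF(2) by (auto simp: V_simps intro!: NI[of _ 0 0 0 0])
    show "v \<oplus>\<^bsub>?W\<^esub> w \<in> N" if vw: "v \<in> N" "w \<in> N" for v w
    proof -
      obtain a b c d where v: "v \<in> U" "a \<in> F" "b \<in> F" "c \<in> F" "d \<in> F" "?P v a b c d" using NE[OF vw(1)] by blast
      obtain a' b' c' d' where w: "w \<in> U" "a' \<in> F" "b' \<in> F" "c' \<in> F" "d' \<in> F" "?P w a' b' c' d'"
        using NE[OF vw(2)] by blast
      have "dim_vec w = 3" using w(1) UF(1) by (auto simp: V_simps)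
      then have "?P (v + w) (a + a') (b + b') (c + c') (d + d')"
        using v(6) w(6) by (simp add: algebra_simps)
      then have "v + w \<in> N" using v w UF(3) by (intro NI[of _ "a + a'" "b + b'" "c + c'" "d + d'"]) simp_all
      then show ?thesis by (simp add: V_simps)
    qed
    show "e \<odot>\<^bsub>?W\<^esub> v \<in> N" if ev: "e \<in> carrier (field_on F)" "v \<in> N" for e v
    proof -
      obtain a b c d where v: "v \<in> U" "a \<in> F" "b \<in> F" "c \<in> F" "d \<in> F" "?P v a b c d" using NE[OF ev(2)] by blast
      have e: "e \<in> F" using ev by (simp add: field_on_carrier)
      have "dim_vec v = 3" using v(1) UF(1) by (auto simp: V_simps)
      then have "?P (e \<cdot>\<^sub>v v) (e * a) (e * b) (e * c) (e * d)"
        using v(6) by (simp add: algebra_simps)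
      then have "e \<cdot>\<^sub>v v \<in> N" using v e UF(4) by (intro NI[of _ "e * a" "e * b" "e * c" "e * d"]) simp_all
      then show ?thesis by (simp add: V_simps)
    qed
  qed
  moreover have "A \<subseteq> N"
  proof
    fix x assume "x \<in> A"
    then consider "x = h1" | "x = h2" | "x = h3" | "x = h4" using Ah by auto
    then show "x \<in> N"
    proof cases
      case 1 then show ?thesis using hU' by (intro NI[of x 1 0 0 0]) simp_all
    next
      case 2 then show ?thesis using hU' by (intro NI[of x 0 1 0 0]) simp_all
    next
      case 3 then show ?thesis using hU' by (intro NI[of x 0 0 1 0]) simp_all
    next
      case 4 then show ?thesis using hU' by (intro NI[of x 0 0 0 1]) simp_all
    qed
  qed
  ultimately have "U \<subseteq> N" using W.span_is_subset[of A N] A(4) by simp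
  then show ?thesis using hU' by (intro that[of h1 h2 h3 h4]) (auto simp: N_def)
qed

text \<open>An uncovered vector spans a point that no two points of the linear set can
  saturate.\<close>

theorem saturating_dim_ge_5:
  assumes "rank_saturating_system E F 3 2 U"
  shows "dim_over E F 3 U \<ge> 5"
proof (rule ccontr)
  assume "\<not> ?thesis"
  then have dim: "dim_over E F 3 U \<le> 4" by simp
  have U: "VectorSpace.subspace (field_on F) U V" and sat: "\<And>Q. Q \<in> PG E 3 \<Longrightarrow> saturated_by E 3 2 (linear_set E 3 U) Q"
    using assms by (auto simp: rank_saturating_system_def saturating_set_def)
  note UF = subspace_F_facts[OF U]
  obtain h1 h2 h3 h4 where h: "{h1, h2, h3, h4} \<subseteq> U" and gen: "\<And>u. u \<in> U \<Longrightarrow> \<exists>a\<in>F. \<exists>b\<in>F. \<exists>c\<in>F. \<exists>d\<in>F. \<forall>i<3.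
    u $ i = a * h1 $ i + b * h2 $ i + c * h3 $ i + d * h4 $ i"
    using four_generators[OF U dim] by blast
  have hE: "h1 $ i \<in> E" "h2 $ i \<in> E" "h3 $ i \<in> E" "h4 $ i \<in> E" if "i < 3" for i
    using h UF(1) that by (auto simp: V_simps)
  obtain v where v: "\<forall>i<3. v i \<in> E" "\<not> covered (($) h1) (($) h2) (($) h3) (($) h4) v"
    using uncovered[of "($) h1" "($) h2" "($) h3" "($) h4"] hE by blast
  have cov: "covered (($) h1) (($) h2) (($) h3) (($) h4) v"
    if u: "u \<in> U" "w \<in> U" "l \<in> E" "m \<in> E" "\<And>i. i < 3 \<Longrightarrow> v i = l * u $ i + m * w $ i" for u w l m
  proof -
    obtain a b c d where a: "a \<in> F" "b \<in> F" "c \<in> F" "d \<in> F"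
      "\<And>i. i < 3 \<Longrightarrow> u $ i = a * h1 $ i + b * h2 $ i + c * h3 $ i + d * h4 $ i" using gen[OF u(1)] by blast
    obtain a' b' c' d' where a': "a' \<in> F" "b' \<in> F" "c' \<in> F" "d' \<in> F"
      "\<And>i. i < 3 \<Longrightarrow> w $ i = a' * h1 $ i + b' * h2 $ i + c' * h3 $ i + d' * h4 $ i" using gen[OF u(2)] by blast
    show ?thesis
      by (rule coveredI[OF u(3,4) comb2I[OF a(1) a'(1)] comb2I[OF a(2) a'(2)] comb2I[OF a(3) a'(3)] comb2I[OF a(4) a'(4)]])
        (simp add: u(5) a(5) a'(5) algebra_simps)
  qed
  let ?v = "vec 3 v"
  have vV: "?v \<in> carrier V" using v(1) by (auto simp: V_simps)
  \<comment> \<open>The zero vector is covered, with both scalars zero, so the uncovered vector does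
    define a point.\<close>
  have "?v \<noteq> 0\<^sub>v 3"
  proof
    assume *: "?v = 0\<^sub>v 3"
    have "v i = 0" if "i < 3" for i using arg_cong[OF *, of "\<lambda>x. x $ i"] that by simp
    then show False using cov[of "0\<^sub>v 3" "0\<^sub>v 3" 0 0] UF(2) v(2) by simp
  qed
  then have "span_over E 3 {?v} \<in> PG E 3" using vV by (auto simp: PG_def)
  from sat[OF this] obtain Ps where Ps: "length Ps = 2" "set Ps \<subseteq> linear_set E 3 U"
    "span_over E 3 {?v} \<subseteq> span_over E 3 (\<Union>(set Ps))" by (auto simp: saturated_by_def)
  obtain P1 P2 where P: "Ps = [P1, P2]" using Ps(1) by (auto simp: numeral_2_eq_2 length_Suc_conv)
  obtain u w where uw: "u \<in> U" "w \<in> U" "P1 = span_over E 3 {u}" "P2 = span_over E 3 {w}"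
    using Ps(2) unfolding P linear_set_def by auto
  have uwV: "u \<in> carrier V" "w \<in> carrier V" using uw UF(1) by auto
  have "?v \<in> span_over E 3 (\<Union>(set Ps))" using span_over_superset[of "{?v}"] vV Ps(3) by blast
  then obtain l m where lm: "?v = l \<cdot>\<^sub>v u + m \<cdot>\<^sub>v w" "l \<in> E" "m \<in> E"
    using span_over_pair[OF uwV] by (auto simp: P uw(3,4))
  have "v i = l * u $ i + m * w $ i" if "i < 3" for i
    using arg_cong[OF lm(1), of "\<lambda>x. x $ i"] that uwV by (auto simp: V_simps)
  then show False using cov[OF uw(1,2) lm(2,3)] v(2) by blast
qed

section \<open>The upper bound\<close>

definition K :: "'a set" where
  "K = GF (q ^ 2)"

lemma card_K: "card K = q ^ 2"
  using card_GF[OF prime_char q_char(2)[of 2]] h2 by (simp add: K_def)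

lemma finite_K [simp]: "finite K"
  using card_K q4 by (auto intro!: card_ge_0_finite)

lemmas K_closed = GF_closed[OF prime_char q_char(2)[of 2], folded K_def]

lemma K_simps [simp]:
  "0 \<in> K" "1 \<in> K" "x \<in> K \<Longrightarrow> y \<in> K \<Longrightarrow> x + y \<in> K" "x \<in> K \<Longrightarrow> y \<in> K \<Longrightarrow> x * y \<in> K"
  "x \<in> K \<Longrightarrow> - x \<in> K" "x \<in> K \<Longrightarrow> inverse x \<in> K" "x \<in> K \<Longrightarrow> y \<in> K \<Longrightarrow> x - y \<in> K"
  "x \<in> K \<Longrightarrow> y \<in> K \<Longrightarrow> x / y \<in> K"
  using K_closed(3)[of x "- y"] by (auto simp: K_closed divide_inverse simp del: uminus_eq)

lemma F_sub_K [simp]: "x \<in> F \<Longrightarrow> x \<in> K"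
  using GF_subset_GF_power by (auto simp: F_def K_def)

lemma K_sub_E [simp]: "x \<in> K \<Longrightarrow> x \<in> E"
  using GF_subset_GF_power[of "q ^ 2" 2] by (auto simp: E_def K_def simp flip: power_mult)

text \<open>For any \<open>\<omega>\<close> outside \<open>F\<close> the \<open>q ^ 2\<close>
  combinations of 1 and \<open>\<omega>\<close> are distinct, so they exhaust
  \<open>K\<close>.\<close>

lemma K_basis: "\<exists>\<omega>\<in>K. \<forall>x\<in>K. \<exists>a\<in>F. \<exists>b\<in>F. x = a + b * \<omega>"
proof -
  have "\<not> K \<subseteq> F"
  proof
    assume "K \<subseteq> F"
    then have "card K \<le> card F" by (intro card_mono) auto
    then show False using q4 by (simp add: card_K card_F power2_eq_square)
  qed
  then obtain \<omega> where \<omega>: "\<omega> \<in> K" "\<omega> \<notin> F" by blast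
  let ?f = "\<lambda>(a, b). a + b * \<omega>"
  have inj: "inj_on ?f (F \<times> F)"
  proof (rule inj_onI)
    fix s t assume st: "s \<in> F \<times> F" "t \<in> F \<times> F" "?f s = ?f t"
    obtain a b c d where e: "s = (a, b)" "t = (c, d)" by (cases s, cases t) auto
    have eq: "(b - d) * \<omega> = c - a" using st(3) by (simp add: e algebra_simps del: uminus_eq)
    have "b = d"
    proof (rule ccontr)
      assume "b \<noteq> d"
      then have "\<omega> = (c - a) / (b - d)" using eq by (simp add: field_simps del: uminus_eq)
      then show False using \<omega>(2) st(1,2) by (simp add: e)
    qed
    then show "s = t" using st(3) by (simp add: e)
  qed
  have im: "?f ` (F \<times> F) = K"
    by (rule card_subset_eq)
      (auto simp: card_image[OF inj] card_K card_F card_cartesian_product power2_eq_square \<omega>)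
  have "\<exists>a\<in>F. \<exists>b\<in>F. x = a + b * \<omega>" if "x \<in> K" for x
  proof -
    have "x \<in> ?f ` (F \<times> F)" using that im by simp
    then obtain s where "s \<in> F \<times> F" "x = ?f s" by (rule imageE)
    then show ?thesis by (cases s) auto
  qed
  then show ?thesis using \<omega>(1) by blast
qed

text \<open>Pigeonhole: \<open>q ^ 6\<close> coefficient triples have at most \<open>q ^ 4\<close>
  values.\<close>

lemma K_relation:
  assumes "x \<in> E" "y \<in> E" "z \<in> E"
  shows "\<exists>a\<in>K. \<exists>b\<in>K. \<exists>c\<in>K. (a \<noteq> 0 \<or> b \<noteq> 0 \<or> c \<noteq> 0) \<and> a * x + b * y + c * z = 0"
proof -
  let ?f = "\<lambda>(a, b, c). a * x + b * y + c * z"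
  have "?f ` (K \<times> K \<times> K) \<subseteq> E" using assms by auto
  then have "card (?f ` (K \<times> K \<times> K)) \<le> card E" by (intro card_mono) auto
  also have "\<dots> < card (K \<times> K \<times> K)"
    using power_strict_increasing[of 4 6 q] q4
    by (simp add: card_cartesian_product card_E card_K flip: power_add)
  finally have "\<not> inj_on ?f (K \<times> K \<times> K)" by (rule pigeonhole)
  then obtain s t where st: "s \<in> K \<times> K \<times> K" "t \<in> K \<times> K \<times> K" "?f s = ?f t" "s \<noteq> t"
    unfolding inj_on_def by meson
  obtain a b c a' b' c' where e: "s = (a, b, c)" "t = (a', b', c')"
    by (cases s, cases t) auto
  have "(a - a') * x + (b - b') * y + (c - c') * z = ?f s - ?f t"
    by (simp only: e prod.case) (simp only: algebra_simps)
  then have "(a - a') * x + (b - b') * y + (c - c') * z = 0" by (simp only: st(3) diff_self)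
  moreover have "a - a' \<noteq> 0 \<or> b - b' \<noteq> 0 \<or> c - c' \<noteq> 0" using st(4) by (auto simp: e)
  moreover have "a - a' \<in> K" "b - b' \<in> K" "c - c' \<in> K" using st(1,2) by (simp_all add: e)
  ultimately show ?thesis by blast
qed

section \<open>Coordinates and a saturating system of dimension five\<close>

definition vec3 :: "'a \<Rightarrow> 'a \<Rightarrow> 'a \<Rightarrow> 'a vec" where
  "vec3 x y z = vec 3 (\<lambda>i. if i = 0 then x else if i = 1 then y else z)"

lemma vec3_simps [simp]:
  "dim_vec (vec3 x y z) = 3" "vec3 x y z $ 0 = x" "vec3 x y z $ Suc 0 = y" "vec3 x y z $ 2 = z"
  "vec3 x y z \<in> carrier_vec 3"
  by (simp_all add: vec3_def)

lemma all_less_3: "(\<forall>i<3::nat. P i) \<longleftrightarrow> P 0 \<and> P (Suc 0) \<and> P 2"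
proof -
  have "i < 3 \<longleftrightarrow> i = 0 \<or> i = Suc 0 \<or> i = 2" for i :: nat by auto
  then show ?thesis by auto
qed

lemma vec3_eqI:
  assumes "v \<in> carrier_vec 3" "v $ 0 = x" "v $ Suc 0 = y" "v $ 2 = z"
  shows "v = vec3 x y z"
proof (rule eq_vecI)
  have "\<forall>i<3. v $ i = vec3 x y z $ i" using assms by (simp add: all_less_3)
  then show "v $ i = vec3 x y z $ i" if "i < dim_vec (vec3 x y z)" for i using that by simp
qed (use assms in simp)

lemma vec3_add: "vec3 x y z + vec3 x' y' z' = vec3 (x + x') (y + y') (z + z')"
  and vec3_smult: "c \<cdot>\<^sub>v vec3 x y z = vec3 (c * x) (c * y) (c * z)"
  and vec3_zero: "0\<^sub>v 3 = vec3 0 0 0"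
  by (rule vec3_eqI; simp)+

lemma vec3_inject [simp]: "vec3 x y z = vec3 x' y' z' \<longleftrightarrow> x = x' \<and> y = y' \<and> z = z'"
  using vec3_simps by metis

lemma V_vec3: "carrier V = {vec3 x y z | x y z. x \<in> E \<and> y \<in> E \<and> z \<in> E}"
proof (intro equalityI subsetI)
  fix v assume "v \<in> carrier V"
  then have "v \<in> carrier_vec 3" "v $ 0 \<in> E" "v $ Suc 0 \<in> E" "v $ 2 \<in> E" by (simp_all add: V_simps)
  then show "v \<in> {vec3 x y z | x y z. x \<in> E \<and> y \<in> E \<and> z \<in> E}"
    using vec3_eqI[of v "v $ 0" "v $ Suc 0" "v $ 2"] by blast
qed (auto simp: V_simps all_less_3)

lemma vec3_V: "x \<in> E \<Longrightarrow> y \<in> E \<Longrightarrow> z \<in> E \<Longrightarrow> vec3 x y z \<in> carrier V"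
  by (auto simp: V_vec3)

text \<open>A line with coefficients in \<open>K\<close> is spanned by two vectors over
  \<open>K\<close> whose last coordinates are 0 or 1. Hence \<open>F\<close> suffices as the third
  factor, which lowers the \<open>F\<close>-dimension from six to five.\<close>

definition U0 :: "'a vec set" where
  "U0 = {vec3 x y z | x y z. x \<in> K \<and> y \<in> K \<and> z \<in> F}"

lemma U0_I: "x \<in> K \<Longrightarrow> y \<in> K \<Longrightarrow> z \<in> F \<Longrightarrow> vec3 x y z \<in> U0"
  by (auto simp: U0_def)

lemma U0_sub_V: "U0 \<subseteq> carrier V"
  by (auto simp: U0_def V_vec3)

lemma subspace_U0: "VectorSpace.subspace (field_on F) U0 V"
proof (intro VectorSpace.subspace.intro vectorspace_F submoduleI module_F U0_sub_V)
  show "0\<^sub>v 3 \<in> U0" by (simp add: vec3_zero U0_I)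
  show "v + w \<in> U0" if "v \<in> U0" "w \<in> U0" for v w
    using that by (auto simp: U0_def vec3_add)
  show "c \<cdot>\<^sub>v v \<in> U0" if cv: "c \<in> F" "v \<in> U0" for c v
  proof -
    obtain x y z where "v = vec3 x y z" "x \<in> K" "y \<in> K" "z \<in> F" using cv(2) by (auto simp: U0_def)
    then show ?thesis using cv(1) by (auto simp: vec3_smult intro!: U0_I)
  qed
qed

text \<open>The basis 1, \<open>\<omega>\<close> of \<open>K\<close> in each of the first two
  coordinates and 1 in the third generate \<open>U0\<close>.\<close>

lemma dim_U0: "dim_over E F 3 U0 \<le> 5"
proof -
  obtain \<omega> where \<omega>: "\<omega> \<in> K" and basis: "\<And>x. x \<in> K \<Longrightarrow> \<exists>a\<in>F. \<exists>b\<in>F. x = a + b * \<omega>"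
    using K_basis by blast
  interpret V: vectorspace "field_on F" V by (rule vectorspace_F)
  let ?W = "V\<lparr>carrier := U0\<rparr>"
  interpret W: vectorspace "field_on F" ?W by (rule V.subspace_is_vs[OF subspace_U0])
  define A where "A = set [vec3 1 0 0, vec3 \<omega> 0 0, vec3 0 1 0, vec3 0 \<omega> 0, vec3 0 0 1]"
  have AU: "A \<subseteq> U0" using \<omega> by (auto simp: A_def intro!: U0_I)
  interpret S: submodule "field_on F" "W.span A" ?W by (rule W.span_is_submodule) (simp add: AU)
  have AS: "A \<subseteq> W.span A" using W.in_own_span[of A] AU by simp
  have add: "v + w \<in> W.span A" if "v \<in> W.span A" "w \<in> W.span A" for v w
    using S.m_closed[OF that] by (simp add: V_simps)
  have smult: "c \<cdot>\<^sub>v v \<in> W.span A" if "c \<in> F" "v \<in> A" for c v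
    using S.smult_closed[of c v] that AS by (auto simp: V_simps field_on_carrier)
  have "U0 \<subseteq> W.span A"
  proof
    fix u assume "u \<in> U0"
    then obtain x y z where u: "u = vec3 x y z" "x \<in> K" "y \<in> K" "z \<in> F" by (auto simp: U0_def)
    obtain a b where x: "a \<in> F" "b \<in> F" "x = a + b * \<omega>" using basis[OF u(2)] by blast
    obtain c d where y: "c \<in> F" "d \<in> F" "y = c + d * \<omega>" using basis[OF u(3)] by blast
    have "a \<cdot>\<^sub>v vec3 1 0 0 + (b \<cdot>\<^sub>v vec3 \<omega> 0 0 + (c \<cdot>\<^sub>v vec3 0 1 0 + (d \<cdot>\<^sub>v vec3 0 \<omega> 0 + z \<cdot>\<^sub>v vec3 0 0 1))) \<in> W.span A"
      by (intro add smult) (use x y u in \<open>simp_all add: A_def\<close>)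
    also have "a \<cdot>\<^sub>v vec3 1 0 0 + (b \<cdot>\<^sub>v vec3 \<omega> 0 0 + (c \<cdot>\<^sub>v vec3 0 1 0 + (d \<cdot>\<^sub>v vec3 0 \<omega> 0 + z \<cdot>\<^sub>v vec3 0 0 1))) = u"
      by (simp add: u(1) x(3) y(3) vec3_add vec3_smult)
    finally show "u \<in> W.span A" .
  qed
  then have "W.span A = carrier ?W" using S.subset by auto
  then have "W.dim \<le> card A" using AU by (intro W.gen_ge_dim) (auto simp: A_def)
  \<comment> \<open>The length of the list bounds the cardinality without a proof that its entries
    are distinct.\<close>
  also have "card A \<le> 5" unfolding A_def by (rule order_trans[OF card_length]) simp
  finally show ?thesis by (simp add: dim_over_def)
qed

text \<open>The coordinates of the point satisfy a relation over \<open>K\<close>. Solving it for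
  one coordinate writes the vector as a combination, over \<open>E\<close>, of two nonzero vectors
  of \<open>U0\<close>.\<close>

lemma saturated_U0:
  assumes Q: "Q \<in> PG E 3"
  shows "saturated_by E 3 2 (linear_set E 3 U0) Q"
proof -
  obtain v where v: "v \<in> carrier V" "v \<noteq> 0\<^sub>v 3" "Q = span_over E 3 {v}" using Q by (auto simp: PG_def)
  obtain x y z where xyz: "v = vec3 x y z" "x \<in> E" "y \<in> E" "z \<in> E" using v(1) by (auto simp: V_vec3)
  have sat: ?thesis
    if uw: "u \<in> U0" "w \<in> U0" "u \<noteq> 0\<^sub>v 3" "w \<noteq> 0\<^sub>v 3" "l \<in> E" "m \<in> E" "v = l \<cdot>\<^sub>v u + m \<cdot>\<^sub>v w" for u w l m
  proof -
    let ?Ps = "[span_over E 3 {u}, span_over E 3 {w}]"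
    let ?S = "\<Union>(set ?Ps)"
    have uV: "{u} \<subseteq> carrier V" "{w} \<subseteq> carrier V" using uw U0_sub_V by auto
    have SV: "?S \<subseteq> carrier V" using span_over_closed(1)[OF uV(1)] span_over_closed(1)[OF uV(2)] by simp
    have "u \<in> span_over E 3 ?S" "w \<in> span_over E 3 ?S"
      using span_over_superset[OF SV] span_over_superset[OF uV(1)] span_over_superset[OF uV(2)] by auto
    then have "v \<in> span_over E 3 ?S"
      unfolding uw(7) using uw(5,6) by (intro span_over_closed[OF SV])
    then have "Q \<subseteq> span_over E 3 ?S"
      unfolding v(3) by (intro span_over_least span_over_closed[OF SV]) simp_all
    moreover have "set ?Ps \<subseteq> linear_set E 3 U0"
      using uw(1-4) by (auto simp: linear_set_def)
    ultimately show ?thesis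
      unfolding saturated_by_def by (intro exI[of _ ?Ps]) simp
  qed
  obtain a b c where abc: "a \<in> K" "b \<in> K" "c \<in> K" "a \<noteq> 0 \<or> b \<noteq> 0 \<or> c \<noteq> 0" "a * x + b * y + c * z = 0"
    using K_relation[OF xyz(2-4)] by blast
  consider "a \<noteq> 0" | "b \<noteq> 0" | "a = 0" "b = 0" by blast
  then show ?thesis
  proof cases
    case 1
    then have "x = y * (- b / a) + z * (- c / a)"
      using abc(5) by (simp add: field_simps add_eq_0_iff2)
    then have "v = y \<cdot>\<^sub>v vec3 (- b / a) 1 0 + z \<cdot>\<^sub>v vec3 (- c / a) 0 1"
      by (simp add: xyz(1) vec3_smult vec3_add del: uminus_eq)
    then show ?thesis using xyz abc by (intro sat[of "vec3 (- b / a) 1 0" "vec3 (- c / a) 0 1" y z])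
      (simp_all add: vec3_zero U0_I)
  next
    case 2
    then have "y = x * (- a / b) + z * (- c / b)"
      using abc(5) by (simp add: field_simps add_eq_0_iff2)
    then have "v = x \<cdot>\<^sub>v vec3 1 (- a / b) 0 + z \<cdot>\<^sub>v vec3 0 (- c / b) 1"
      by (simp add: xyz(1) vec3_smult vec3_add del: uminus_eq)
    then show ?thesis using xyz abc by (intro sat[of "vec3 1 (- a / b) 0" "vec3 0 (- c / b) 1" x z])
      (simp_all add: vec3_zero U0_I)
  next
    case 3
    \<comment> \<open>Here \<open>c\<close> is the only nonzero coefficient, and the line is spanned
      by the first two unit vectors.\<close>
    then have "z = 0" using abc by simp
    then have "v = x \<cdot>\<^sub>v vec3 1 0 0 + y \<cdot>\<^sub>v vec3 0 1 0"
      by (simp add: xyz(1) vec3_smult vec3_add)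
    then show ?thesis using xyz by (intro sat[of "vec3 1 0 0" "vec3 0 1 0" x y])
      (simp_all add: vec3_zero U0_I)
  qed
qed

text \<open>This is the minimality of 2. A multiple of a vector of \<open>U0\<close> with nonzero
  first coordinate has the quotient of its first two coordinates in \<open>K\<close>, which fails
  for \<open>(1, \<eta>, 0)\<close>.\<close>

lemma not_saturated_U0:
  assumes "\<forall>Q\<in>PG E 3. saturated_by E 3 r (linear_set E 3 U0) Q"
  shows "2 \<le> r"
proof (rule ccontr)
  assume "\<not> 2 \<le> r"
  have "\<not> E \<subseteq> K"
  proof
    assume "E \<subseteq> K"
    then have "card E \<le> card K" by (intro card_mono) auto
    also have "\<dots> < q ^ 4" using power_strict_increasing[of 2 4 q] q4 by (simp add: card_K)
    finally show False by (simp add: card_E)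
  qed
  then obtain \<eta> where \<eta>: "\<eta> \<in> E" "\<eta> \<notin> K" by blast
  let ?v = "vec3 1 \<eta> 0"
  have vV: "{?v} \<subseteq> carrier V" using \<eta> by (simp add: vec3_V)
  then have "span_over E 3 {?v} \<in> PG E 3" by (auto simp: PG_def vec3_zero)
  then obtain Ps where Ps: "length Ps = r" "set Ps \<subseteq> linear_set E 3 U0"
    "span_over E 3 {?v} \<subseteq> span_over E 3 (\<Union>(set Ps))" using assms unfolding saturated_by_def by meson
  have "\<exists>u\<in>U0. \<Union>(set Ps) \<subseteq> span_over E 3 {u}"
  proof (cases Ps)
    case Nil
    \<comment> \<open>With no points at all, the empty union lies in the span of the zero
      vector.\<close>
    then show ?thesis using U0_I[of 0 0 0] by auto
  next
    case (Cons P Qs)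
    then have "Ps = [P]" using Ps(1) \<open>\<not> 2 \<le> r\<close> by (cases Qs) auto
    then show ?thesis using Ps(2) by (auto simp: linear_set_def)
  qed
  then obtain u where u: "u \<in> U0" "\<Union>(set Ps) \<subseteq> span_over E 3 {u}" by blast
  have uV: "{u} \<subseteq> carrier V" using u U0_sub_V by auto
  have "?v \<in> span_over E 3 {?v}" using span_over_superset[OF vV] by simp
  also have "\<dots> \<subseteq> span_over E 3 (\<Union>(set Ps))" by (rule Ps(3))
  also have "\<dots> \<subseteq> span_over E 3 {u}"
    by (intro span_over_least span_over_closed[OF uV] u(2))
  also have "\<dots> \<subseteq> {c \<cdot>\<^sub>v u | c. c \<in> E}" using uV by (intro span_over_singleton) simp
  finally obtain c where c: "?v = c \<cdot>\<^sub>v u" by blast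
  obtain x y z where xyz: "u = vec3 x y z" "x \<in> K" "y \<in> K" "z \<in> F" using u(1) by (auto simp: U0_def)
  have "1 = c * x" "\<eta> = c * y" using c by (auto simp: xyz(1) vec3_smult)
  then have "\<eta> = y / x" by (metis mult.commute nonzero_divide_eq_eq mult_zero_right zero_neq_one mult.assoc mult_1_right)
  then show False using \<eta>(2) xyz by simp
qed

lemma linear_set_sub_PG: "linear_set E 3 U0 \<subseteq> PG E 3"
  using U0_sub_V by (auto simp: linear_set_def PG_def)

text \<open>The lower bound applied to \<open>U0\<close> itself turns \<open>dim_U0\<close> into an
  equality, so the value 5 is attained.\<close>

theorem min_saturating_rank_eq_5: "min_saturating_rank E F 3 2 = 5"
proof -
  have "rank_saturating_system E F 3 2 U0"
    unfolding rank_saturating_system_def saturating_set_def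
    using subspace_U0 linear_set_sub_PG saturated_U0 not_saturated_U0 by blast
  moreover from this have "dim_over E F 3 U0 = 5"
    using saturating_dim_ge_5 dim_U0 by (simp add: order_antisym)
  ultimately show ?thesis
    unfolding min_saturating_rank_def using saturating_dim_ge_5
    by (intro cInf_eq_minimum) auto
qed

end

theorem theorem3p2:
  shows "\<exists>q\<^sub>0. \<forall>q\<ge>q\<^sub>0. primepow q \<and> even q \<longrightarrow>
    min_saturating_rank (GF (q ^ 4) :: bit alg_closure set) (GF q) 3 2 = 5"
proof (intro exI[of _ 4] allI impI)
  fix q :: nat assume "q \<ge> 4" and q: "primepow q \<and> even q"
  obtain p h where ph: "prime p" "h > 0" "q = p ^ h"
    using q by (auto simp: primepow_def)
  with q have "p = 2" by (metis even_power primes_dvd_imp_eq two_is_prime_nat)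
  \<comment> \<open>The threshold 4 is what yields the bound \<open>h \<ge> 2\<close> of the
    locale.\<close>
  have "h \<noteq> 1" using \<open>q \<ge> 4\<close> ph \<open>p = 2\<close> by auto
  then interpret quartic_extension "GF q" "GF (q ^ 4) :: bit alg_closure set" q h
    using ph \<open>p = 2\<close> by unfold_locales auto
  show "min_saturating_rank (GF (q ^ 4) :: bit alg_closure set) (GF q) 3 2 = 5"
    by (rule min_saturating_rank_eq_5)
qed

end
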